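(* Let $q$ be an odd prime power, let $h\in\mathbb{F}_{q^6}$ with $h^{q^3+1}=-1$, and let $f_h(x)=h^{q-1}x^q-h^{q^2-1}x^{q^2}+x^{q^4}+x^{q^5}$. Then $\mathcal{C}_{f_h}$ is an $\mathbb{F}_q$-linear MRD-code with parameters $(6,6,q;5)$ and with left idealiser isomorphic to $\mathbb{F}_{q^6}$. Moreover, apart from the case in which $h\in\mathbb{F}_q$ and $q$ is a power of $5$, $\mathcal{C}_{f_h}$ is not equivalent to any previously known MRD-code, i.e. it is not equivalent to any code $\mathcal{C}_g$ with $g$ one of the following scattered $q$-polynomials over $\mathbb{F}_{q^6}$: (1) $g(x)=x^q$; (2) $g(x)=\delta x^q+x^{q^5}$ with $\mathrm{N}_{q^6/q}(\delta)\notin\{0,1\}$; (3) $g(x)=x^q+\delta x^{q^4}$ with $\mathrm{N}_{q^6/q^3}(\delta)\notin\{0,1\}$ and such that $g$ is scattered; (4) $g(x)=x^q+x^{q^3}+\delta x^{q^5}$ with $\delta\in\mathbb{F}_{q^6}$, $\delta^2+\delta=1$.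
   Context: For a $q$-polynomial $f(x)=\sum_{i=0}^{5}a_ix^{q^i}\in\mathbb{F}_{q^6}[x]$, $f$ is scattered if the set of points $\{\langle (x,f(x))\rangle_{\mathbb{F}_{q^6}}:x\in\mathbb{F}_{q^6}^*\}$ of $\mathrm{PG}(1,q^6)$ has size $(q^6-1)/(q-1)$. Put $\mathcal{C}_f=\{x\mapsto af(x)+bx : a,b\in\mathbb{F}_{q^6}\}$, a set of $\mathbb{F}_q$-linear endomorphisms of $\mathbb{F}_{q^6}$; after fixing an $\mathbb{F}_q$-basis of $\mathbb{F}_{q^6}$ it is regarded as a subset of $\mathbb{F}_q^{6\times 6}$. $\mathrm{N}_{q^6/q^e}$ denotes the norm from $\mathbb{F}_{q^6}$ to $\mathbb{F}_{q^e}$. A rank metric code is a subset $\mathcal{C}\subseteq\mathbb{F}_q^{m\times n}$ with distance $d(A,B)=\mathrm{rk}(A-B)$; it has parameters $(m,n,q;d)$ if its minimum distance is $d$; it is $\mathbb{F}_q$-linear if it is an $\mathbb{F}_q$-subspace; it is MRD if $|\mathcal{C}|=q^{\max\{m,n\}(\min\{m,n\}-d+1)}$. Two $\mathbb{F}_q$-linear codes $\mathcal{C},\mathcal{C}'\subseteq\mathbb{F}_q^{m\times m}$ are equivalent if there exist invertible $A,B\in\mathbb{F}_q^{m\times m}$ and a field automorphism $\sigma$ of $\mathbb{F}_q$ such that $\{AC^\sigma B:C\in\mathcal{C}\}=\mathcal{C}'$ or $\{AC^{T\sigma}B:C\in\mathcal{C}\}=\mathcal{C}'$, where $T$ denotes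 transposition and $\sigma$ acts entrywise. The left idealiser of $\mathcal{C}\subseteq\mathbb{F}_q^{m\times m}$ is $L(\mathcal{C})=\{A\in\mathbb{F}_q^{m\times m}: A\mathcal{C}\subseteq\mathcal{C}\}$, where the matrix product corresponds to composition of endomorphisms (with $A$ applied after the element of $\mathcal{C}$). *)

theory Defs
  imports "HOL-Analysis.Analysis" "HOL-Number_Theory.Prime_Powers"
begin

definition field_embedding :: "('k::field \<Rightarrow> 'l::field) \<Rightarrow> bool" where
  "field_embedding \<iota> \<longleftrightarrow>
     \<iota> 1 = 1 \<and> (\<forall>x y. \<iota> (x + y) = \<iota> x + \<iota> y) \<and> (\<forall>x y. \<iota> (x * y) = \<iota> x * \<iota> y)"

definition field_automorphism :: "('k::field \<Rightarrow> 'k) \<Rightarrow> bool" where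
  "field_automorphism \<sigma> \<longleftrightarrow> field_embedding \<sigma> \<and> bij \<sigma>"

subsection \<open>Rank metric codes\<close>

text \<open>A matrix with m rows and n columns over \<open>'k\<close> has type \<open>'k^'n^'m\<close>.\<close>

definition mat_scale :: "'k::field \<Rightarrow> 'k^'n^'m \<Rightarrow> 'k^'n^'m" where
  "mat_scale c = map_matrix (\<lambda>x. c * x)"

lemma vector_space_mat_scale: "vector_space (mat_scale :: 'k::field \<Rightarrow> 'k^'n^'m \<Rightarrow> 'k^'n^'m)"
  by unfold_locales (auto simp: mat_scale_def vec_eq_iff algebra_simps)

definition linear_code :: "('k::field^'n^'m) set \<Rightarrow> bool" where
  "linear_code C \<longleftrightarrow> module.subspace mat_scale C"

definition rank_dist :: "'k::field^'n^'m \<Rightarrow> 'k^'n^'m \<Rightarrow> nat" where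
  "rank_dist A B = rank (A - B)"

definition min_distance :: "('k::field^'n^'m) set \<Rightarrow> nat \<Rightarrow> bool" where
  "min_distance C d \<longleftrightarrow>
     (\<exists>A\<in>C. \<exists>B\<in>C. A \<noteq> B \<and> rank_dist A B = d) \<and>
     (\<forall>A\<in>C. \<forall>B\<in>C. A \<noteq> B \<longrightarrow> d \<le> rank_dist A B)"

definition code_parameters ::
  "('k::{field,finite}^'n^'m) set \<Rightarrow> nat \<Rightarrow> nat \<Rightarrow> nat \<Rightarrow> nat \<Rightarrow> bool" where
  "code_parameters C m n q d \<longleftrightarrow>
     CARD('m) = m \<and> CARD('n) = n \<and> CARD('k) = q \<and> min_distance C d"

definition MRD_code :: "('k::{field,finite}^'n^'m) set \<Rightarrow> bool" where
  "MRD_code C \<longleftrightarrow>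
     (\<exists>d. min_distance C d \<and>
        card C = CARD('k) ^ (max CARD('m) CARD('n) * (min CARD('m) CARD('n) - d + 1)))"

definition code_equivalent :: "('k::field^'n^'n) set \<Rightarrow> ('k^'n^'n) set \<Rightarrow> bool" where
  "code_equivalent C C' \<longleftrightarrow>
     (\<exists>A B \<sigma>. invertible A \<and> invertible B \<and> field_automorphism \<sigma> \<and>
        ((\<lambda>M. A ** map_matrix \<sigma> M ** B) ` C = C' \<or>
         (\<lambda>M. A ** map_matrix \<sigma> (transpose M) ** B) ` C = C'))"

definition left_idealiser :: "('k::field^'n^'n) set \<Rightarrow> ('k^'n^'n) set" where
  "left_idealiser C = {A. \<forall>M\<in>C. A ** M \<in> C}"

text \<open>Isomorphism as rings; the ring structure on \<open>'k^'n^'n\<close> is given by \<open>+\<close>, \<open>**\<close> and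
  \<open>mat 1\<close>, as \<open>*\<close> and \<open>1\<close> on vectors are componentwise.\<close>

definition matrix_ring_iso :: "('l::field \<Rightarrow> 'k::field^'n^'n) \<Rightarrow> ('k^'n^'n) set \<Rightarrow> bool" where
  "matrix_ring_iso \<phi> S \<longleftrightarrow>
     bij_betw \<phi> UNIV S \<and> \<phi> 1 = mat 1 \<and>
     (\<forall>x y. \<phi> (x + y) = \<phi> x + \<phi> y) \<and> (\<forall>x y. \<phi> (x * y) = \<phi> x ** \<phi> y)"

subsection \<open>Matrices of endomorphisms\<close>

text \<open>\<open>\<iota>\<close> is an embedding of the field \<open>'k\<close> into the field \<open>'l\<close>, making \<open>'l\<close> a
  \<open>'k\<close>-vector space.\<close>

definition ext_scale :: "('k::field \<Rightarrow> 'l::field) \<Rightarrow> 'k \<Rightarrow> 'l \<Rightarrow> 'l" where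
  "ext_scale \<iota> c x = \<iota> c * x"

lemma vector_space_ext_scale: "field_embedding \<iota> \<Longrightarrow> vector_space (ext_scale \<iota>)"
  by unfold_locales (auto simp: field_embedding_def ext_scale_def algebra_simps)

definition ext_basis :: "('k::field \<Rightarrow> 'l::field) \<Rightarrow> ('n::finite \<Rightarrow> 'l) \<Rightarrow> bool" where
  "ext_basis \<iota> b \<longleftrightarrow>
     inj b \<and> \<not> module.dependent (ext_scale \<iota>) (range b) \<and>
     module.span (ext_scale \<iota>) (range b) = UNIV"

definition lin_comb :: "('k::field \<Rightarrow> 'l::field) \<Rightarrow> ('n::finite \<Rightarrow> 'l) \<Rightarrow> 'k^'n \<Rightarrow> 'l" where
  "lin_comb \<iota> b v = (\<Sum>i\<in>UNIV. ext_scale \<iota> (v $ i) (b i))"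

text \<open>For a basis \<open>b\<close>, the map \<open>lin_comb \<iota> b\<close> is bijective and its inverse takes coordinates.
  Coordinates are columns, so \<open>A ** endo_matrix \<iota> b \<phi>\<close> corresponds to applying \<open>\<phi>\<close> first.\<close>

definition endo_matrix ::
  "('k::field \<Rightarrow> 'l::field) \<Rightarrow> ('n::finite \<Rightarrow> 'l) \<Rightarrow> ('l \<Rightarrow> 'l) \<Rightarrow> 'k^'n^'n" where
  "endo_matrix \<iota> b \<phi> = matrix (inv (lin_comb \<iota> b) \<circ> \<phi> \<circ> lin_comb \<iota> b)"

subsection \<open>Codes of \<open>q\<close>-polynomials\<close>

text \<open>A \<open>q\<close>-polynomial is represented by the function on \<open>'l\<close> it induces.\<close>

definition poly_code :: "('l::field \<Rightarrow> 'l) \<Rightarrow> ('l \<Rightarrow> 'l) set" where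
  "poly_code f = {\<lambda>x. a * f x + b * x |a b. True}"

definition poly_matrix_code ::
  "('k::field \<Rightarrow> 'l::field) \<Rightarrow> ('n::finite \<Rightarrow> 'l) \<Rightarrow> ('l \<Rightarrow> 'l) \<Rightarrow> ('k^'n^'n) set" where
  "poly_matrix_code \<iota> b f = endo_matrix \<iota> b ` poly_code f"

text \<open>Points of the projective line are one-dimensional subspaces of \<open>'l^2\<close>.\<close>

definition scattered :: "nat \<Rightarrow> ('l::{field,finite} \<Rightarrow> 'l) \<Rightarrow> bool" where
  "scattered q f \<longleftrightarrow>
     card {vec.span {vector [x, f x] :: 'l^2} |x. x \<noteq> 0} = (q ^ 6 - 1) div (q - 1)"

text \<open>Norm from the field with \<open>q ^ 6\<close> elements to its subfield with \<open>q ^ e\<close> elements, where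
  \<open>e\<close> divides 6: the product of the Galois conjugates.\<close>

definition norm6 :: "nat \<Rightarrow> nat \<Rightarrow> 'l::field \<Rightarrow> 'l" where
  "norm6 q e x = (\<Prod>i<6 div e. x ^ (q ^ (e * i)))"

definition f_poly :: "nat \<Rightarrow> 'l::field \<Rightarrow> 'l \<Rightarrow> 'l" where
  "f_poly q h x =
     h ^ (q - 1) * x ^ q - h ^ (q\<^sup>2 - 1) * x ^ (q ^ 2) + x ^ (q ^ 4) + x ^ (q ^ 5)"

inductive_set known_scattered :: "nat \<Rightarrow> ('l::{field,finite} \<Rightarrow> 'l) set" for q :: nat where
  pseudoregulus: "(\<lambda>x. x ^ q) \<in> known_scattered q"
| lunardon_polverino: "norm6 q 1 \<delta> \<notin> {0, 1} \<Longrightarrow>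
    (\<lambda>x. \<delta> * x ^ q + x ^ (q ^ 5)) \<in> known_scattered q"
| binomial: "norm6 q 3 \<delta> \<notin> {0, 1} \<Longrightarrow> scattered q (\<lambda>x. x ^ q + \<delta> * x ^ (q ^ 4)) \<Longrightarrow>
    (\<lambda>x. x ^ q + \<delta> * x ^ (q ^ 4)) \<in> known_scattered q"
| trinomial: "\<delta>\<^sup>2 + \<delta> = 1 \<Longrightarrow>
    (\<lambda>x. x ^ q + x ^ (q ^ 3) + \<delta> * x ^ (q ^ 5)) \<in> known_scattered q"

end

theory Submission
  imports Defs
begin

text \<open>
  Write \<open>x\<^sub>i\<close> for \<open>x ^ (q ^ i)\<close>, and \<open>b = h\<^sub>1\<close>, \<open>c = h\<^sub>2\<close>. The norm condition says
  \<open>h\<^sub>3 = -1/h\<close>, so the Frobenius map shifts \<open>h, b, c, -1/h, -1/b, -1/c\<close> cyclically and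
  \<open>f(x) = (b/h) x\<^sub>1 - (c/h) x\<^sub>2 + x\<^sub>4 + x\<^sub>5\<close>.

  Minimum distance. It suffices that any two nonzero solutions \<open>x, y\<close> of \<open>f(z) = m z\<close> are
  proportional over the field with \<open>q\<close> elements. Comparing the equation with its image under
  the third Frobenius power separates \<open>x\<^sub>1, x\<^sub>4\<close> from \<open>x\<^sub>2, x\<^sub>5\<close>: the pair \<open>(x\<^sub>1, x\<^sub>4)\<close> is tied to
  \<open>(x, x\<^sub>3)\<close> by two linear equations over the large field. Let \<open>w = x y\<^sub>3 - y x\<^sub>3\<close> and
  \<open>D = b c m\<^sub>3 - m\<close>. Taking determinants shows that \<open>D w / (b + c)\<close> is fixed by the
  Frobenius map, whereas the third Frobenius power negates this element. As \<open>q\<close> is odd, \<open>D w = 0\<close>.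
  If \<open>w \<noteq> 0\<close> then \<open>D = 0\<close>, the linear equations become dependent, and \<open>m / (b + c)\<close> would be
  a \<open>g\<close> with \<open>g g\<^sub>1 = -1\<close> and \<open>g\<^sub>3 = -g\<close>, which does not exist. If \<open>w = 0\<close> then \<open>y/x\<close> is fixed
  by the third Frobenius power and the separated equations finish the argument
  (lemma \<open>eigenvectors_proportional\<close>). Counting vectors over the small field turns kernel
  sizes into ranks.

  Idealisers. Additive polynomials of \<open>q\<close>-degree below 6 are determined by their values, so
  composition identities can be compared coefficient by coefficient. This shows that the left
  idealiser consists of the multiplications by field elements, and that the right
  idealiser has at most \<open>q ^ 5\<close> elements.

  Inequivalence. Every code of a \<open>q\<close>-polynomial has all \<open>q ^ 6\<close> field multiplications in its
  left idealiser. An equivalence involving the transpose would embed these into the right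
  idealiser of the code of \<open>f\<close>, which is too small. An equivalence without
  transpose conjugates the multiplications into multiplications, so its left factor is a
  field automorphism \<open>\<theta>\<close> up to a scalar (lemma \<open>semilinear_idealiser_map\<close>). What
  remains is an identity \<open>g(\<alpha> f'(y) + \<beta> y) = \<alpha>' f'(y) + \<beta>' y\<close>, where \<open>f'\<close> belongs to
  the parameter \<open>\<theta>(h)\<close> of the same family. Coefficient comparison refutes it for
  each of the four types of \<open>g\<close>, except that for the trinomial it forces \<open>h\<^sub>1 = h\<close>
  and \<open>5 = 0\<close>.
\<close>

section \<open>Field embeddings and matrices over finite fields\<close>

lemma field_embedding_hom:
  assumes "field_embedding \<iota>"
  shows "\<iota> 0 = 0" "\<iota> 1 = 1" "\<iota> (x + y) = \<iota> x + \<iota> y" "\<iota> (x * y) = \<iota> x * \<iota> y"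
    "\<iota> (- x) = - \<iota> x" "\<iota> (x - y) = \<iota> x - \<iota> y" "\<iota> (x ^ n) = \<iota> x ^ n" "\<iota> (sum u A) = (\<Sum>i\<in>A. \<iota> (u i))"
proof -
  show 1: "\<iota> 1 = 1" and add: "\<And>x y. \<iota> (x + y) = \<iota> x + \<iota> y" and mult: "\<And>x y. \<iota> (x * y) = \<iota> x * \<iota> y"
    using assms by (auto simp: field_embedding_def)
  show 0: "\<iota> 0 = 0"
    using add[of 0 0] by (metis add_cancel_right_right add_0)
  show neg: "\<iota> (- x) = - \<iota> x" for x
    using add[of x "- x"] 0 by (simp add: eq_neg_iff_add_eq_0 add.commute)
  show "\<iota> (x - y) = \<iota> x - \<iota> y"
    using add[of x "- y"] by (simp add: neg)
  show "\<iota> (x ^ n) = \<iota> x ^ n"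
    by (induction n) (simp_all add: 1 mult)
  show "\<iota> (sum u A) = (\<Sum>i\<in>A. \<iota> (u i))"
    by (induction A rule: infinite_finite_induct) (simp_all add: 0 add)
qed

lemma field_embedding_inj:
  assumes "field_embedding \<iota>"
  shows "inj \<iota>"
proof (rule injI, rule ccontr)
  fix x y assume eq: "\<iota> x = \<iota> y" and "x \<noteq> y"
  have "\<iota> ((x - y) * inverse (x - y)) = 0"
    using eq by (simp only: field_embedding_hom(4,6)[OF assms]) simp
  then show False
    using \<open>x \<noteq> y\<close> by (simp add: field_embedding_hom(2)[OF assms])
qed

text \<open>The half of the rank-nullity theorem that bounds the rank from below, by counting: evaluation
  at a basis of the row space has the kernel of the matrix as its kernel, and its target
  has \<open>CARD('k) ^ rank A\<close> elements.\<close>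
lemma card_kernel_ge:
  fixes A :: "'k::{field,finite}^'n^'m"
  shows "CARD('k) ^ CARD('n) \<le> card {v. A *v v = 0} * CARD('k) ^ rank A"
proof -
  obtain B where B: "B \<subseteq> rows A" "vec.independent B" "rows A \<subseteq> vec.span B" "card B = vec.dim (rows A)"
    using vec.basis_exists by metis
  define ev where "ev v = (\<lambda>w\<in>B. \<Sum>j\<in>UNIV. w $ j * v $ j)" for v :: "'k^'n"
  have ker: "A *v v = 0" if orth: "\<And>w. w \<in> B \<Longrightarrow> (\<Sum>j\<in>UNIV. w $ j * v $ j) = 0" for v
  proof -
    have "vec.subspace {w. (\<Sum>j\<in>UNIV. w $ j * v $ j) = 0}"
      by (auto simp: vec.subspace_def sum.distrib distrib_right mult.assoc simp flip: sum_distrib_left)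
    then have "vec.span B \<subseteq> {w. (\<Sum>j\<in>UNIV. w $ j * v $ j) = 0}"
      using orth by (intro vec.span_minimal) auto
    then have "(\<Sum>j\<in>UNIV. row i A $ j * v $ j) = 0" for i
      using B(3) by (auto simp: rows_def)
    then show ?thesis
      by (simp add: matrix_vector_mult_def vec_eq_iff row_def)
  qed
  have fib: "card (ev -` {y}) \<le> card {v. A *v v = 0}" for y
  proof (cases "ev -` {y} = {}")
    case False
    then obtain u where u: "ev u = y" by auto
    have "(\<lambda>v. v - u) ` (ev -` {y}) \<subseteq> {v. A *v v = 0}"
    proof clarsimp
      fix v assume v: "y = ev v"
      show "A *v (v - u) = 0"
      proof (rule ker)
        fix w assume w: "w \<in> B"
        have "ev v w = ev u w" using u v by simp
        then show "(\<Sum>j\<in>UNIV. w $ j * (v - u) $ j) = 0"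
          using w by (simp add: ev_def right_diff_distrib sum_subtractf)
      qed
    qed
    then have "card ((\<lambda>v. v - u) ` (ev -` {y})) \<le> card {v. A *v v = 0}"
      by (intro card_mono) auto
    then show ?thesis
      by (subst (asm) card_image) (auto simp: inj_on_def)
  qed auto
  have fB: "finite B" by simp
  let ?T = "B \<rightarrow>\<^sub>E (UNIV :: 'k set)"
  have "(UNIV :: ('k^'n) set) = (\<Union>y\<in>?T. ev -` {y})"
    by (auto simp: ev_def)
  then have "CARD('k^'n) \<le> (\<Sum>y\<in>?T. card (ev -` {y}))"
    by (metis card_UN_le finite_PiE fB finite)
  also have "\<dots> \<le> (\<Sum>y\<in>?T. card {v. A *v v = 0})"
    by (intro sum_mono fib)
  also have "\<dots> = card {v. A *v v = 0} * CARD('k) ^ rank A"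
    using fB B(4) by (simp add: card_PiE row_rank_def_gen)
  finally show ?thesis by simp
qed

lemma rank_less_if_kernel:
  fixes A :: "'k::field^'n^'m"
  assumes "A *v v = 0" "v \<noteq> 0"
  shows "rank A < CARD('n)"
proof -
  have "rank A \<le> CARD('n)"
    unfolding row_rank_def_gen by (rule dim_subset_UNIV_cart_gen)
  moreover have "rank A \<noteq> CARD('n)"
  proof
    assume "rank A = CARD('n)"
    then have "vec.span (rows A) = UNIV"
      unfolding row_rank_def_gen
      using vec.dim_eq_full[of "rows A"]
      by (simp add: vec_dim_card vec.dimension_def flip: vec.dim_UNIV)
    then obtain B where "B ** A = mat 1"
      using matrix_left_invertible_span_rows_gen by metis
    then show False
      using assms by (metis matrix_vector_mul_assoc matrix_vector_mul_lid matrix_vector_mult_0_right)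
  qed
  ultimately show ?thesis by simp
qed

lemma map_matrix_mult:
  assumes "field_embedding \<sigma>"
  shows "map_matrix \<sigma> (M ** N) = map_matrix \<sigma> M ** map_matrix \<sigma> N"
  by (simp add: vec_eq_iff matrix_matrix_mult_def field_embedding_hom[OF assms])

lemma map_matrix_inj: "inj \<sigma> \<Longrightarrow> inj (map_matrix \<sigma>)"
  by (auto simp: inj_def vec_eq_iff)

lemma map_matrix_surj: "surj \<sigma> \<Longrightarrow> surj (map_matrix \<sigma>)"
  by (rule surjI[of _ "map_matrix (inv \<sigma>)"]) (simp add: vec_eq_iff surj_f_inv_f)

text \<open>An equivalence \<open>M \<mapsto> A M\<^sup>\<sigma> B\<close> of codes conjugates left idealisers into each other: \<open>N\<close> in the
  idealiser of the image comes from the matrix \<open>P\<close> with \<open>P\<^sup>\<sigma> = A\<^sup>-\<^sup>1 N A\<close>.\<close>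
lemma left_idealiser_conjugate:
  fixes A B :: "'k::{field,finite}^'n^'n"
  assumes "invertible A" "invertible B" and \<sigma>: "field_automorphism \<sigma>"
    and eq: "(\<lambda>M. A ** map_matrix \<sigma> M ** B) ` C = C'" and N: "N \<in> left_idealiser C'"
  shows "\<exists>P \<in> left_idealiser C. N ** A = A ** map_matrix \<sigma> P"
proof -
  have emb: "field_embedding \<sigma>" and "bij \<sigma>" using \<sigma> by (auto simp: field_automorphism_def)
  obtain A' where A': "A ** A' = mat 1" "A' ** A = mat 1" using assms(1) by (auto simp: invertible_def)
  obtain B' where B': "B ** B' = mat 1" using assms(2) by (auto simp: invertible_def)
  obtain P where P: "map_matrix \<sigma> P = A' ** N ** A"
    using map_matrix_surj[OF bij_is_surj[OF \<open>bij \<sigma>\<close>]] by (metis surjD)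
  have NA: "N ** A = A ** map_matrix \<sigma> P"
    by (simp add: P A' matrix_mul_assoc)
  have "P ** M \<in> C" if M: "M \<in> C" for M
  proof -
    have "N ** (A ** map_matrix \<sigma> M ** B) \<in> C'"
      using N M eq by (auto simp: left_idealiser_def)
    then obtain M' where M': "M' \<in> C" "N ** (A ** map_matrix \<sigma> M ** B) = A ** map_matrix \<sigma> M' ** B"
      using eq by auto
    have "A' ** (N ** (A ** map_matrix \<sigma> M ** B)) ** B' = A' ** (A ** map_matrix \<sigma> M' ** B) ** B'"
      using M'(2) by simp
    moreover have "A' ** (N ** (A ** map_matrix \<sigma> M ** B)) ** B'
        = (A' ** N ** A) ** map_matrix \<sigma> M ** (B ** B')"
      by (simp only: matrix_mul_assoc)
    moreover have "A' ** (A ** map_matrix \<sigma> M' ** B) ** B' = (A' ** A) ** map_matrix \<sigma> M' ** (B ** B')"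
      by (simp only: matrix_mul_assoc)
    ultimately have "map_matrix \<sigma> (P ** M) = map_matrix \<sigma> M'"
      by (simp add: A' B' P map_matrix_mult[OF emb])
    then have "P ** M = M'"
      by (rule injD[OF map_matrix_inj[OF bij_is_inj[OF \<open>bij \<sigma>\<close>]]])
    then show ?thesis using M' by simp
  qed
  then show ?thesis using NA by (auto simp: left_idealiser_def)
qed

definition map_vec :: "('a \<Rightarrow> 'b) \<Rightarrow> 'a^'n \<Rightarrow> 'b^'n" where
  "map_vec \<sigma> v = (\<chi> i. \<sigma> (v $ i))"

lemma map_vec_mult: "field_embedding \<sigma> \<Longrightarrow> map_vec \<sigma> (M *v v) = map_matrix \<sigma> M *v map_vec \<sigma> v"
  by (simp add: map_vec_def vec_eq_iff matrix_vector_mult_def field_embedding_hom)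

lemma map_vec_add: "field_embedding \<sigma> \<Longrightarrow> map_vec \<sigma> (u + v) = map_vec \<sigma> u + map_vec \<sigma> v"
  by (simp add: map_vec_def vec_eq_iff field_embedding_hom)

lemma map_vec_inj: "inj \<sigma> \<Longrightarrow> inj (map_vec \<sigma>)"
  by (auto simp: inj_def map_vec_def vec_eq_iff)

section \<open>Matrices of endomorphisms and codes of linear maps\<close>

locale extension_basis =
  fixes \<iota> :: "'k::field \<Rightarrow> 'l::field" and b :: "'n::finite \<Rightarrow> 'l"
  assumes embedding: "field_embedding \<iota>" and basis: "ext_basis \<iota> b"
begin

lemmas emb_hom = field_embedding_hom[OF embedding]

abbreviation lc :: "'k^'n \<Rightarrow> 'l" where "lc \<equiv> lin_comb \<iota> b"
abbreviation coords :: "'l \<Rightarrow> 'k^'n" where "coords \<equiv> inv (lin_comb \<iota> b)"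
abbreviation E :: "('l \<Rightarrow> 'l) \<Rightarrow> 'k^'n^'n" where "E \<equiv> endo_matrix \<iota> b"

definition base_linear :: "('l \<Rightarrow> 'l) \<Rightarrow> bool" where
  "base_linear \<phi> \<longleftrightarrow> (\<forall>x y. \<phi> (x + y) = \<phi> x + \<phi> y) \<and> (\<forall>c x. \<phi> (\<iota> c * x) = \<iota> c * \<phi> x)"

lemma lc_add: "lc (u + v) = lc u + lc v"
  by (simp add: lin_comb_def ext_scale_def emb_hom distrib_right sum.distrib)

lemma lc_scale: "lc (c *s v) = \<iota> c * lc v"
  by (simp add: lin_comb_def ext_scale_def emb_hom sum_distrib_left mult.assoc)

lemma lc_0: "lc 0 = 0"
  by (simp add: lin_comb_def ext_scale_def emb_hom)

lemma bij_lc: "bij lc"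
proof -
  interpret V: vector_space "ext_scale \<iota>"
    using embedding by (rule vector_space_ext_scale)
  have b: "inj b" "V.independent (range b)" "V.span (range b) = UNIV"
    using basis by (auto simp: ext_basis_def)
  have zero: "v = 0" if v: "lc v = 0" for v
  proof -
    have "(\<Sum>w\<in>range b. ext_scale \<iota> (v $ inv b w) w) = 0"
      using v b(1) by (simp add: sum.reindex lin_comb_def)
    then have "\<forall>w\<in>range b. v $ inv b w = 0"
      using b(2) V.dependent_finite[of "range b"] by auto
    then show ?thesis using b(1) by (auto simp: vec_eq_iff)
  qed
  have "inj lc"
  proof (rule injI)
    fix u v assume "lc u = lc v"
    then have "lc (u - v) = 0"
      using lc_add[of "u - v" v] by simp
    then show "u = v" using zero[of "u - v"] by simp
  qed
  moreover have "surj lc"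
  proof -
    have "\<exists>v. x = lc v" for x
    proof -
      have "x \<in> range (\<lambda>u. \<Sum>w\<in>range b. ext_scale \<iota> (u w) w)"
        using b(3) V.span_finite[of "range b"] by auto
      then obtain u where "x = (\<Sum>w\<in>range b. ext_scale \<iota> (u w) w)" by auto
      then have "x = lc (\<chi> i. u (b i))"
        using b(1) by (simp add: sum.reindex lin_comb_def)
      then show ?thesis by blast
    qed
    then show ?thesis by (auto simp: surj_def)
  qed
  ultimately show ?thesis by (simp add: bij_def)
qed

lemma lc_coords [simp]: "lc (coords x) = x"
  using bij_lc by (simp add: bij_is_surj surj_f_inv_f)

lemma coords_lc [simp]: "coords (lc v) = v"
  using bij_lc by (simp add: bij_is_inj)

lemma lc_eq_iff: "lc u = lc v \<longleftrightarrow> u = v"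
  using bij_lc by (auto simp: bij_def inj_def)

lemma E_works:
  assumes "base_linear \<phi>"
  shows "lc (E \<phi> *v v) = \<phi> (lc v)"
proof -
  have "Vector_Spaces.linear (*s) (*s) (coords \<circ> \<phi> \<circ> lc)"
  proof (unfold_locales, simp_all)
    fix u v c
    show "coords (\<phi> (lc (u + v))) = coords (\<phi> (lc u)) + coords (\<phi> (lc v))"
      using assms by (subst lc_eq_iff[symmetric]) (simp add: lc_add base_linear_def)
    show "coords (\<phi> (lc (c *s v))) = c *s coords (\<phi> (lc v))"
      using assms by (subst lc_eq_iff[symmetric]) (simp add: lc_scale base_linear_def)
  qed
  then show ?thesis
    unfolding endo_matrix_def by (subst matrix_works) simp_all
qed

lemma E_eqI:
  assumes "\<And>v. lc (M *v v) = lc (N *v v)"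
  shows "M = N"
  using assms by (simp add: lc_eq_iff matrix_eq)

lemma E_inj:
  assumes "base_linear \<phi>" "base_linear \<psi>" "E \<phi> = E \<psi>"
  shows "\<phi> = \<psi>"
proof
  fix x show "\<phi> x = \<psi> x"
    using E_works[OF assms(1), of "coords x"] E_works[OF assms(2), of "coords x"] assms(3) by simp
qed

lemma base_linear_comp: "base_linear \<phi> \<Longrightarrow> base_linear \<psi> \<Longrightarrow> base_linear (\<phi> \<circ> \<psi>)"
  by (simp add: base_linear_def)

lemma base_linear_add: "base_linear \<phi> \<Longrightarrow> base_linear \<psi> \<Longrightarrow> base_linear (\<lambda>x. \<phi> x + \<psi> x)"
  by (simp add: base_linear_def algebra_simps)

lemma base_linear_diff: "base_linear \<phi> \<Longrightarrow> base_linear \<psi> \<Longrightarrow> base_linear (\<lambda>x. \<phi> x - \<psi> x)"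
  by (simp add: base_linear_def algebra_simps)

lemma base_linear_scale: "base_linear \<phi> \<Longrightarrow> base_linear (\<lambda>x. c * \<phi> x)"
  by (simp add: base_linear_def algebra_simps)

lemma base_linear_mult: "base_linear (\<lambda>x. c * x)"
  by (simp add: base_linear_def algebra_simps)

lemma E_comp: "base_linear \<phi> \<Longrightarrow> base_linear \<psi> \<Longrightarrow> E (\<phi> \<circ> \<psi>) = E \<phi> ** E \<psi>"
  by (rule E_eqI) (simp add: E_works base_linear_comp flip: matrix_vector_mul_assoc)

lemma E_add: "base_linear \<phi> \<Longrightarrow> base_linear \<psi> \<Longrightarrow> E (\<lambda>x. \<phi> x + \<psi> x) = E \<phi> + E \<psi>"
  by (rule E_eqI) (simp add: E_works base_linear_add matrix_vector_mult_add_rdistrib lc_add)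

lemma E_diff: "base_linear \<phi> \<Longrightarrow> base_linear \<psi> \<Longrightarrow> E (\<lambda>x. \<phi> x - \<psi> x) = E \<phi> - E \<psi>"
  using E_add[of "\<lambda>x. \<phi> x - \<psi> x" \<psi>] by (simp add: base_linear_diff)

lemma E_scale:
  assumes "base_linear \<phi>"
  shows "E (\<lambda>x. \<iota> c * \<phi> x) = mat_scale c (E \<phi>)"
proof (rule E_eqI)
  fix v
  have "mat_scale c (E \<phi>) *v v = c *s (E \<phi> *v v)"
    by (simp add: mat_scale_def vec_eq_iff matrix_vector_mult_def sum_distrib_left mult.assoc)
  then show "lc (E (\<lambda>x. \<iota> c * \<phi> x) *v v) = lc (mat_scale c (E \<phi>) *v v)"
    using assms by (simp add: E_works base_linear_scale lc_scale)
qed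

lemma E_id: "E (\<lambda>x. x) = mat 1"
  by (rule E_eqI) (simp add: E_works base_linear_def)

lemma E_zero: "E (\<lambda>x. 0) = 0"
  by (rule E_eqI) (simp add: E_works base_linear_def lc_0)

lemma card_kernel_E:
  assumes "base_linear \<phi>"
  shows "card {v. E \<phi> *v v = 0} = card {x. \<phi> x = 0}"
proof -
  have "bij_betw lc {v. E \<phi> *v v = 0} {x. \<phi> x = 0}"
  proof (rule bij_betwI[where g = coords])
    show "lc \<in> {v. E \<phi> *v v = 0} \<rightarrow> {x. \<phi> x = 0}"
      using E_works[OF assms] lc_0 by (auto simp flip: E_works[OF assms])
    show "coords \<in> {x. \<phi> x = 0} \<rightarrow> {v. E \<phi> *v v = 0}"
      using E_works[OF assms] by (auto simp: lc_0 simp flip: lc_eq_iff)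
  qed auto
  then show ?thesis by (rule bij_betw_same_card)
qed

lemma poly_code_base_linear:
  assumes "base_linear g" "\<phi> \<in> poly_code g"
  shows "base_linear \<phi>"
  using assms by (auto simp: poly_code_def intro!: base_linear_add base_linear_scale base_linear_mult)

lemma poly_matrix_code_linear:
  assumes g: "base_linear g"
  shows "linear_code (poly_matrix_code \<iota> b g)"
proof -
  interpret V: vector_space "mat_scale :: 'k \<Rightarrow> 'k^'n^'n \<Rightarrow> 'k^'n^'n"
    by (rule vector_space_mat_scale)
  note lin = poly_code_base_linear[OF g]
  have "0 \<in> poly_matrix_code \<iota> b g"
    unfolding poly_matrix_code_def E_zero[symmetric]
    by (intro imageI) (auto simp: poly_code_def intro!: exI[of _ 0])
  moreover have "E \<phi> + E \<psi> \<in> poly_matrix_code \<iota> b g" if mem: "\<phi> \<in> poly_code g" "\<psi> \<in> poly_code g" for \<phi> \<psi>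
  proof -
    obtain a d a' d' where \<phi>: "\<phi> = (\<lambda>x. a * g x + d * x)" and \<psi>: "\<psi> = (\<lambda>x. a' * g x + d' * x)"
      using mem unfolding poly_code_def by blast
    have "(\<lambda>x. \<phi> x + \<psi> x) = (\<lambda>x. (a + a') * g x + (d + d') * x)"
      by (simp add: \<phi> \<psi> algebra_simps)
    then have "(\<lambda>x. \<phi> x + \<psi> x) \<in> poly_code g" unfolding poly_code_def by blast
    then show ?thesis
      using lin mem by (auto simp: poly_matrix_code_def E_add[symmetric])
  qed
  moreover have "mat_scale r (E \<phi>) \<in> poly_matrix_code \<iota> b g" if mem: "\<phi> \<in> poly_code g" for \<phi> r
  proof -
    obtain a d where \<phi>: "\<phi> = (\<lambda>x. a * g x + d * x)"
      using mem unfolding poly_code_def by blast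
    have "(\<lambda>x. \<iota> r * \<phi> x) = (\<lambda>x. (\<iota> r * a) * g x + (\<iota> r * d) * x)"
      by (simp add: \<phi> algebra_simps)
    then have "(\<lambda>x. \<iota> r * \<phi> x) \<in> poly_code g" unfolding poly_code_def by blast
    then show ?thesis
      using lin mem by (auto simp: poly_matrix_code_def E_scale[symmetric])
  qed
  ultimately show ?thesis
    unfolding linear_code_def V.subspace_def by (auto simp: poly_matrix_code_def)
qed

lemma E_mem_code_iff:
  assumes g: "base_linear g" "base_linear \<phi>"
  shows "E \<phi> \<in> poly_matrix_code \<iota> b g \<longleftrightarrow> (\<exists>a d. \<forall>x. \<phi> x = a * g x + d * x)"
proof
  assume "E \<phi> \<in> poly_matrix_code \<iota> b g"
  then obtain \<psi> where "\<psi> \<in> poly_code g" "E \<phi> = E \<psi>" by (auto simp: poly_matrix_code_def)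
  moreover from this have "\<phi> = \<psi>" using E_inj poly_code_base_linear g by blast
  ultimately show "\<exists>a d. \<forall>x. \<phi> x = a * g x + d * x" by (auto simp: poly_code_def)
next
  assume "\<exists>a d. \<forall>x. \<phi> x = a * g x + d * x"
  then obtain a d where "\<phi> = (\<lambda>x. a * g x + d * x)" by auto
  then have "\<phi> \<in> poly_code g" by (auto simp: poly_code_def)
  then show "E \<phi> \<in> poly_matrix_code \<iota> b g" by (simp add: poly_matrix_code_def)
qed

lemma mem_codeE:
  assumes g: "base_linear g" and "M \<in> poly_matrix_code \<iota> b g"
  obtains a d where "M = E (\<lambda>x. a * g x + d * x)" "base_linear (\<lambda>x. a * g x + d * x)"
proof -
  obtain \<psi> where "\<psi> \<in> poly_code g" "M = E \<psi>" using assms by (auto simp: poly_matrix_code_def)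
  moreover from this have "base_linear \<psi>" using poly_code_base_linear g by blast
  moreover obtain a d where "\<psi> = (\<lambda>x. a * g x + d * x)" using \<open>\<psi> \<in> poly_code g\<close> by (auto simp: poly_code_def)
  ultimately show ?thesis using that by blast
qed

lemma id_mem_code: "mat 1 \<in> poly_matrix_code \<iota> b g"
proof -
  have "(\<lambda>x. 0 * g x + 1 * x) \<in> poly_code g"
    unfolding poly_code_def by blast
  then show ?thesis by (simp add: poly_matrix_code_def flip: E_id)
qed

lemma E_mem_code:
  assumes g: "base_linear g"
  shows "E g \<in> poly_matrix_code \<iota> b g"
proof -
  have "(\<lambda>x. 1 * g x + 0 * x) \<in> poly_code g"
    unfolding poly_code_def by blast
  then show ?thesis by (simp add: poly_matrix_code_def)
qed

lemma mult_mem_left_idealiser: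
  assumes g: "base_linear g"
  shows "E (\<lambda>x. \<beta> * x) \<in> left_idealiser (poly_matrix_code \<iota> b g)"
  unfolding left_idealiser_def
proof safe
  fix M assume "M \<in> poly_matrix_code \<iota> b g"
  then obtain a d where M: "M = E (\<lambda>x. a * g x + d * x)" and lin: "base_linear (\<lambda>x. a * g x + d * x)"
    using mem_codeE[OF g] by metis
  have "E (\<lambda>x. \<beta> * x) ** M = E ((\<lambda>x. \<beta> * x) \<circ> (\<lambda>x. a * g x + d * x))"
    unfolding M using lin base_linear_mult by (simp add: E_comp)
  also have "(\<lambda>x. \<beta> * x) \<circ> (\<lambda>x. a * g x + d * x) = (\<lambda>x. (\<beta> * a) * g x + (\<beta> * d) * x)"
    by (auto simp: algebra_simps)
  also have "E \<dots> \<in> poly_matrix_code \<iota> b g"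
    unfolding poly_matrix_code_def poly_code_def by blast
  finally show "E (\<lambda>x. \<beta> * x) ** M \<in> poly_matrix_code \<iota> b g" .
qed

lemma mult_E_inj: "E (\<lambda>x. \<beta> * x) = E (\<lambda>x. \<gamma> * x) \<Longrightarrow> \<beta> = \<gamma>"
  using E_inj[OF base_linear_mult base_linear_mult, of \<beta> \<gamma>] by (metis mult.right_neutral)

text \<open>The semilinear bijection \<open>\<Phi>\<close> given by \<open>A\<close> and \<open>\<sigma>\<close> satisfies \<open>\<Phi>(\<tau>(\<beta>) x) = \<beta> \<Phi>(x)\<close>. As \<open>\<tau>\<close> is
  bijective, \<open>\<Phi>\<close> is determined by \<open>\<Phi>(1)\<close> and \<open>\<tau>\<close>: after division by \<open>e = \<Phi>(1)\<close> it is the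
  inverse of \<open>\<tau>\<close>, and the identity for \<open>\<Phi>\<close> makes it multiplicative.\<close>
lemma semilinear_idealiser_map:
  fixes A :: "'k^'n^'n"
  assumes A: "invertible A" and \<sigma>: "field_automorphism \<sigma>" and fin: "finite (UNIV :: 'l set)"
    and \<tau>: "\<And>\<beta>. E (\<lambda>x. \<beta> * x) ** A = A ** map_matrix \<sigma> (E (\<lambda>x. \<tau> \<beta> * x))"
  obtains \<theta> e where "field_automorphism \<theta>" "e \<noteq> 0"
    "\<And>\<psi> x. base_linear \<psi> \<Longrightarrow>
       lc ((A ** map_matrix \<sigma> (E \<psi>)) *v map_vec \<sigma> (coords x)) = e * \<theta> (\<psi> x)"
proof -
  have emb: "field_embedding \<sigma>" and "bij \<sigma>" using \<sigma> by (auto simp: field_automorphism_def)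
  define \<Phi> where "\<Phi> x = lc (A *v map_vec \<sigma> (coords x))" for x
  have \<Phi>: "lc ((A ** map_matrix \<sigma> (E \<psi>)) *v map_vec \<sigma> (coords x)) = \<Phi> (\<psi> x)" if "base_linear \<psi>" for \<psi> x
  proof -
    have "coords (\<psi> x) = E \<psi> *v coords x"
      using E_works[OF that, of "coords x"] by (simp flip: lc_eq_iff)
    then show ?thesis
      by (simp add: \<Phi>_def map_vec_mult[OF emb] matrix_vector_mul_assoc)
  qed
  have \<Phi>_add: "\<Phi> (x + y) = \<Phi> x + \<Phi> y" for x y
  proof -
    have "coords (x + y) = coords x + coords y"
      by (simp add: lc_add flip: lc_eq_iff)
    then show ?thesis
      by (simp add: \<Phi>_def map_vec_add[OF emb] matrix_vector_right_distrib lc_add)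
  qed
  have "inj \<Phi>"
  proof (rule injI)
    fix x y assume "\<Phi> x = \<Phi> y"
    obtain A' where A': "A' ** A = mat 1" using A by (auto simp: invertible_def)
    have "A *v map_vec \<sigma> (coords x) = A *v map_vec \<sigma> (coords y)"
      using \<open>\<Phi> x = \<Phi> y\<close> by (simp add: \<Phi>_def lc_eq_iff)
    then have "map_vec \<sigma> (coords x) = map_vec \<sigma> (coords y)"
      using A' by (metis matrix_vector_mul_assoc matrix_vector_mul_lid)
    then have "coords x = coords y"
      by (rule injD[OF map_vec_inj[OF bij_is_inj[OF \<open>bij \<sigma>\<close>]]])
    then show "x = y" by (metis lc_coords)
  qed
  have \<Phi>_0: "\<Phi> 0 = 0" using \<Phi>_add[of 0 0] by (metis add_cancel_right_right add_0)
  have e: "\<Phi> 1 \<noteq> 0" using \<open>inj \<Phi>\<close> \<Phi>_0 by (metis injD zero_neq_one)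
  have \<Phi>_\<tau>: "\<Phi> (\<tau> \<beta> * x) = \<beta> * \<Phi> x" for \<beta> x
  proof -
    have "\<Phi> (\<tau> \<beta> * x) = lc ((E (\<lambda>x. \<beta> * x) ** A) *v map_vec \<sigma> (coords x))"
      using \<Phi>[OF base_linear_mult, of "\<tau> \<beta>" x] by (simp add: \<tau>)
    also have "\<dots> = lc (E (\<lambda>x. \<beta> * x) *v (A *v map_vec \<sigma> (coords x)))"
      by (simp add: matrix_vector_mul_assoc)
    also have "\<dots> = \<beta> * \<Phi> x"
      using E_works[OF base_linear_mult, of \<beta>] by (simp add: \<Phi>_def)
    finally show ?thesis .
  qed
  have "inj \<tau>"
    using \<Phi>_\<tau>[of _ 1] e by (metis injI mult_right_cancel)
  then have "surj \<tau>" by (rule finite_UNIV_inj_surj[OF fin])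
  define \<theta> where "\<theta> y = \<Phi> y / \<Phi> 1" for y
  have \<Phi>_\<theta>: "\<Phi> y = \<Phi> 1 * \<theta> y" for y using e by (simp add: \<theta>_def)
  have \<theta>_mult: "\<theta> (y * x) = \<theta> y * \<theta> x" for x y
  proof -
    obtain \<beta> where y: "y = \<tau> \<beta>" using \<open>surj \<tau>\<close> by auto
    have "\<theta> y = \<beta>" using \<Phi>_\<tau>[of \<beta> 1] e by (simp add: \<theta>_def y)
    then show ?thesis using \<Phi>_\<tau>[of \<beta> x] by (simp add: \<theta>_def y)
  qed
  have "field_embedding \<theta>"
    unfolding field_embedding_def
    using \<theta>_mult e by (auto simp: \<theta>_def \<Phi>_add add_divide_distrib)
  then have "field_automorphism \<theta>"
    unfolding field_automorphism_def bij_def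
    using field_embedding_inj finite_UNIV_inj_surj[OF fin] by blast
  then show ?thesis
  proof (rule that)
    show "\<Phi> 1 \<noteq> 0" by (rule e)
    show "lc ((A ** map_matrix \<sigma> (E \<psi>)) *v map_vec \<sigma> (coords x)) = \<Phi> 1 * \<theta> (\<psi> x)"
      if "base_linear \<psi>" for \<psi> x
      unfolding \<Phi>[OF that] by (rule \<Phi>_\<theta>)
  qed
qed

end

section \<open>The Frobenius map on a finite field\<close>

text \<open>The \<open>i\<close>-th power of the Frobenius map over the field with \<open>q\<close> elements.\<close>
definition frob :: "nat \<Rightarrow> nat \<Rightarrow> 'l::field \<Rightarrow> 'l" where
  "frob q i x = x ^ (q ^ i)"

text \<open>Multiplication by \<open>x \<noteq> 0\<close> permutes the nonzero elements, so it preserves their product.\<close>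
lemma finite_field_fermat:
  fixes x :: "'l::{field,finite}"
  shows "x ^ CARD('l) = x"
proof (cases "x = 0")
  case False
  define U where "U = UNIV - {0::'l}"
  have "(\<Prod>y\<in>U. y) = (\<Prod>y\<in>U. x * y)"
    by (rule prod.reindex_bij_witness[of _ "\<lambda>y. x * y" "\<lambda>y. y / x"]) (use False in \<open>auto simp: U_def\<close>)
  also have "\<dots> = x ^ card U * (\<Prod>y\<in>U. y)"
    by (simp add: prod.distrib)
  finally have "x ^ card U = 1"
    by (simp add: U_def)
  moreover have "CARD('l) = Suc (card U)"
    unfolding U_def by (rule card_Suc_Diff1[symmetric]) auto
  ultimately show ?thesis by simp
qed (simp add: zero_power)

text \<open>Adding 1 permutes the field, so the sum of all elements shows that the cardinality is 0 in
  the field; hence the characteristic is the prime of which \<open>q\<close> is a power.\<close>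
lemma primepow_card_CHAR:
  assumes "primepow q" "CARD('l::{field,finite}) = q ^ n"
  obtains k where "prime CHAR('l)" "k > 0" "q = CHAR('l) ^ k"
proof -
  obtain p k where pk: "prime p" "k > 0" "q = p ^ k"
    using assms(1) by (auto simp: primepow_def)
  have pr: "prime CHAR('l)"
    by (simp add: prime_CHAR_semidom finite_imp_CHAR_pos)
  have "(\<Sum>z\<in>UNIV. z) = (\<Sum>z\<in>UNIV. z + (1::'l))"
    by (rule sum.reindex_bij_witness[of _ "\<lambda>z. z + 1" "\<lambda>z. z - 1"]) auto
  then have "of_nat CARD('l) = (0::'l)"
    by (simp add: sum.distrib)
  then have "CHAR('l) dvd p ^ (k * n)"
    by (simp only: of_nat_eq_0_iff_char_dvd assms(2) pk(3) power_mult)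
  then have "CHAR('l) = p"
    using pr pk(1) by (metis prime_dvd_power primes_dvd_imp_eq)
  then show ?thesis using that pr pk by blast
qed

lemma frob_add:
  fixes x y :: "'l::{field,finite}"
  assumes "primepow q" "CARD('l) = q ^ n"
  shows "frob q i (x + y) = frob q i x + frob q i y"
proof -
  obtain k where "prime CHAR('l)" "q = CHAR('l) ^ k"
    using primepow_card_CHAR[OF assms] by metis
  then show ?thesis
    unfolding frob_def by (intro freshmans_dream'[where n = "k * i"]) (simp_all add: power_mult)
qed

lemma frob_mult: "frob q i (x * y) = frob q i x * frob q i y"
  by (simp add: frob_def power_mult_distrib)

lemma frob_divide: "frob q i (x / y) = frob q i x / frob q i y"
  by (simp add: frob_def power_divide)

lemma frob_0: "q > 0 \<Longrightarrow> frob q i 0 = 0"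
  by (simp add: frob_def power_0_left)

lemma frob_1: "frob q i 1 = 1"
  by (simp add: frob_def)

lemma frob_power: "frob q i (x ^ n) = frob q i x ^ n"
  by (simp add: frob_def mult.commute flip: power_mult)

lemma frob_frob: "frob q i (frob q j x) = frob q (i + j) x"
  by (simp add: frob_def power_add mult.commute flip: power_mult)

lemma frob_period:
  fixes x :: "'l::{field,finite}"
  assumes "CARD('l) = q ^ n"
  shows "frob q n x = x"
  using finite_field_fermat[of x] by (simp add: frob_def assms)

text \<open>A polynomial of degree at most \<open>q ^ m\<close> that vanishes on a larger field is zero. In particular
  the powers of the Frobenius map below the degree of the extension are linearly independent.\<close>
lemma frob_sum_eq_0:
  fixes c :: "nat \<Rightarrow> 'l::{field,finite}"
  assumes card: "CARD('l) > q ^ m" and q: "q > 1"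
    and zero: "\<And>x. (\<Sum>i\<le>m. c i * frob q i x) = 0" and "i \<le> m"
  shows "c i = 0"
proof -
  define p where "p = (\<Sum>i\<le>m. monom (c i) (q ^ i))"
  have coeff: "poly.coeff p (q ^ i) = (if i \<le> m then c i else 0)" for i
    using q by (simp add: p_def coeff_sum)
  have "poly p x = 0" for x
    using zero[of x] by (simp add: p_def poly_sum poly_monom frob_def)
  then have roots: "{x. poly p x = 0} = UNIV" by simp
  have deg: "degree p \<le> q ^ m"
    unfolding p_def using q
    by (intro degree_sum_le) (auto intro!: order.trans[OF degree_monom_le] power_increasing)
  have "p = 0"
  proof (rule ccontr)
    assume "p \<noteq> 0"
    then have "CARD('l) \<le> degree p"
      using card_poly_roots_bound[of p] roots by simp
    then show False using deg card by simp
  qed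
  then show ?thesis using coeff[of i] \<open>i \<le> m\<close> by simp
qed

text \<open>The form in which coefficients are compared later, for additive polynomials of
  \<open>q\<close>-degree at most 5.\<close>
lemma frob_coeffs_eq:
  fixes c0 :: "'l::{field,finite}"
  assumes "CARD('l) = q ^ 6" "q > 1"
    and eq: "\<And>x. c0 * x + c1 * frob q 1 x + c2 * frob q 2 x + c3 * frob q 3 x + c4 * frob q 4 x + c5 * frob q 5 x
      = d0 * x + d1 * frob q 1 x + d2 * frob q 2 x + d3 * frob q 3 x + d4 * frob q 4 x + d5 * frob q 5 x"
  shows "c0 = d0" "c1 = d1" "c2 = d2" "c3 = d3" "c4 = d4" "c5 = d5"
proof -
  define e where "e = (!) [c0 - d0, c1 - d1, c2 - d2, c3 - d3, c4 - d4, c5 - d5]"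
  have "(\<Sum>i\<le>5. e i * frob q i x) = 0" for x
  proof -
    have "{..5::nat} = {0, 1, 2, 3, 4, 5}" by auto
    moreover have "frob q 0 x = x" by (simp add: frob_def)
    ultimately show ?thesis
      using eq[of x] by (simp add: e_def algebra_simps)
  qed
  then have "e i = 0" if "i \<le> 5" for i
    using assms that by (intro frob_sum_eq_0[of q 5 e i]) simp_all
  from this[of 0] this[of 1] this[of 2] this[of 3] this[of 4] this[of 5]
  show "c0 = d0" "c1 = d1" "c2 = d2" "c3 = d3" "c4 = d4" "c5 = d5"
    by (simp_all add: e_def)
qed

lemma card_frob_roots:
  fixes c :: "nat \<Rightarrow> 'l::{field,finite}"
  assumes q: "q > 1" and "c m \<noteq> 0"
  shows "card {x. (\<Sum>i\<le>m. c i * frob q i x) = 0} \<le> q ^ m"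
proof -
  define p where "p = (\<Sum>i\<le>m. monom (c i) (q ^ i))"
  have "poly.coeff p (q ^ m) = c m"
    using q by (simp add: p_def coeff_sum)
  then have "p \<noteq> 0" using assms(2) by auto
  moreover have "degree p \<le> q ^ m"
    unfolding p_def using q
    by (intro degree_sum_le) (auto intro!: order.trans[OF degree_monom_le] power_increasing)
  moreover have "{x. (\<Sum>i\<le>m. c i * frob q i x) = 0} = {x. poly p x = 0}"
    by (simp add: p_def poly_sum poly_monom frob_def)
  ultimately show ?thesis
    using card_poly_roots_bound[of p] by simp
qed

lemma range_embedding_eq_fixed:
  fixes \<iota> :: "'k::{field,finite} \<Rightarrow> 'l::{field,finite}"
  assumes "field_embedding \<iota>" "CARD('k) = q" "q > 1"
  shows "range \<iota> = {x. frob q 1 x = x}"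
proof (rule card_subset_eq)
  show "range \<iota> \<subseteq> {x. frob q 1 x = x}"
    using assms finite_field_fermat[where 'l = 'k]
    by (auto simp: frob_def simp flip: field_embedding_hom(7)[OF assms(1)])
  then have "card (range \<iota>) \<le> card {x::'l. frob q 1 x = x}"
    by (intro card_mono) auto
  moreover have "card {x::'l. (\<Sum>i\<le>1. (if i = 0 then -1 else 1) * frob q i x) = 0} \<le> q ^ 1"
    using assms by (intro card_frob_roots) auto
  then have "card {x::'l. frob q 1 x = x} \<le> q"
    by (simp add: frob_def)
  moreover have "card (range \<iota>) = q"
    using assms by (simp add: card_image field_embedding_inj)
  ultimately show "card (range \<iota>) = card {x::'l. frob q 1 x = x}" by simp
qed simp

section \<open>The family of polynomials\<close>

text \<open>Exponents of the Frobenius map are numerals; rewriting 1 to \<open>Suc 0\<close> would keep the rules for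
  them from matching.\<close>
declare One_nat_def [simp del]

locale f_family =
  fixes q :: nat and h :: "'l::{field,finite}"
  assumes primepow_q: "primepow q" and odd_q: "odd q"
    and card_l: "CARD('l) = q ^ 6" and h_norm: "h ^ (q ^ 3 + 1) = -1"
begin

abbreviation fr where "fr \<equiv> frob q"
definition b where "b = fr 1 h"
definition c where "c = fr 2 h"

lemma q_gt_1: "q > 1"
  using primepow_gt_Suc_0[OF primepow_q] by (simp add: One_nat_def)

lemma two_nonzero: "(2::'l) \<noteq> 0"
proof
  assume "(2::'l) = 0"
  obtain k where k: "prime CHAR('l)" "k > 0" "q = CHAR('l) ^ k"
    using primepow_card_CHAR[OF primepow_q card_l] by metis
  have "CHAR('l) dvd 2"
    using \<open>(2::'l) = 0\<close> by (simp flip: of_nat_eq_0_iff_char_dvd)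
  then have "CHAR('l) = 2"
    using k(1) by (metis primes_dvd_imp_eq two_is_prime_nat)
  then show False using k odd_q by simp
qed

lemma h_nonzero: "h \<noteq> 0"
  using h_norm by (auto simp: zero_power)

lemma fr_add [simp]: "fr i (x + y) = fr i x + fr i (y :: 'l)"
  by (rule frob_add[OF primepow_q card_l])

lemma fr_0 [simp]: "fr i 0 = (0::'l)"
  using q_gt_1 by (simp add: frob_0)

lemma fr_minus [simp]: "fr i (- x) = - fr i (x :: 'l)"
  using fr_add[of i x "- x"] by (simp add: eq_neg_iff_add_eq_0 add.commute del: fr_add)

lemma fr_diff [simp]: "fr i (x - y) = fr i x - fr i (y :: 'l)"
  using fr_add[of i x "- y"] by (simp del: fr_add)

lemma fr_period: "fr (i + 6) x = fr i (x :: 'l)"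
  using frob_period[OF card_l, of "fr i x"] by (simp add: frob_frob add.commute)

lemma fr_reduce [simp]:
  "fr 6 x = (x::'l)" "fr 7 x = fr 1 x" "fr 8 x = fr 2 x" "fr 9 x = fr 3 x" "fr 10 x = fr 4 x"
  using fr_period[of 0 x] fr_period[of 1 x] fr_period[of 2 x] fr_period[of 3 x] fr_period[of 4 x]
  by (simp_all add: frob_def)

lemmas fr_simps [simp] = frob_mult frob_divide frob_1 frob_frob frob_power

lemma fr_eq_0_iff [simp]: "fr i x = 0 \<longleftrightarrow> x = (0::'l)"
  using q_gt_1 by (simp add: frob_def)

lemma b_nonzero: "b \<noteq> 0" and c_nonzero: "c \<noteq> 0"
  by (simp_all add: b_def c_def h_nonzero)

lemmas nonzero [simp] = h_nonzero b_nonzero c_nonzero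

lemma fr_3_h: "fr 3 h = - 1 / h"
proof -
  have "h * fr 3 h = -1"
    using h_norm by (simp add: frob_def power_add mult.commute)
  then show ?thesis by (simp add: field_simps)
qed

text \<open>The Frobenius map takes each element of the cyclic sequence \<open>h, b, c, -1/h, -1/b, -1/c\<close> to the
  next.\<close>
lemma fr_h:
  "fr 1 h = b" "fr 2 h = c" "fr 3 h = - 1 / h" "fr 4 h = - 1 / b" "fr 5 h = - 1 / c"
  "fr 1 b = c" "fr 2 b = - 1 / h" "fr 3 b = - 1 / b" "fr 4 b = - 1 / c" "fr 5 b = h"
  "fr 1 c = - 1 / h" "fr 2 c = - 1 / b" "fr 3 c = - 1 / c" "fr 4 c = h" "fr 5 c = b"
proof -
  show h3: "fr 3 h = - 1 / h" by (rule fr_3_h)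
  show h4: "fr 4 h = - 1 / b" and h5: "fr 5 h = - 1 / c"
    using arg_cong[OF h3, of "fr 1"] arg_cong[OF h3, of "fr 2"] by (simp_all add: b_def c_def)
  show "fr 1 h = b" "fr 2 h = c"
    "fr 1 b = c" "fr 2 b = - 1 / h" "fr 3 b = - 1 / b" "fr 4 b = - 1 / c" "fr 5 b = h"
    "fr 1 c = - 1 / h" "fr 2 c = - 1 / b" "fr 3 c = - 1 / c" "fr 4 c = h" "fr 5 c = b"
    using h3 h4 h5 by (simp_all add: b_def c_def)
qed

lemma fr_eq_iff [simp]: "fr i x = fr i y \<longleftrightarrow> x = (y::'l)"
  using fr_diff[of i x y] by (metis eq_iff_diff_eq_0 fr_eq_0_iff)

text \<open>From \<open>b = -h\<close> follows \<open>h\<^sub>3 = -h\<close>, so \<open>h\<^sup>2 = 1\<close> by the norm condition; but then \<open>h\<close> is \<open>1\<close> or \<open>-1\<close>,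
  hence fixed by the Frobenius map, and \<open>b = h\<close>. The elements \<open>b + c\<close> and \<open>h c - 1\<close>, by which
  later arguments divide, are conjugates of \<open>h + b\<close> up to a nonzero factor.\<close>
lemma h_plus_b: "h + b \<noteq> 0"
proof
  assume "h + b = 0"
  then have b: "b = - h" by (simp add: eq_neg_iff_add_eq_0 add.commute)
  then have c: "c = h"
    using fr_h(6) by (simp add: fr_h)
  have "- 1 / h = - h"
    using fr_h(11) by (simp add: c fr_h b)
  then have "h * h = 1" by (simp add: field_simps)
  then have "h = 1 \<or> h = -1" by (simp add: square_eq_1_iff)
  then have "h = b" using fr_h(1) by auto
  then have "2 * h = 0" using b by (metis \<open>h + b = 0\<close> mult_2)
  then show False using two_nonzero by simp
qed

lemma b_plus_c: "b + c \<noteq> 0"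
  using h_plus_b fr_eq_0_iff[of 1 "h + b"] by (simp add: fr_h)

lemma hc_neq_1: "h * c \<noteq> 1"
proof
  assume "h * c = 1"
  then have "fr 2 (h + b) = 0" by (simp add: fr_h field_simps)
  then show False using h_plus_b by (simp only: fr_eq_0_iff)
qed

lemma f_poly_eq: "f_poly q h x = b / h * fr 1 x - c / h * fr 2 x + fr 4 x + fr 5 x"
proof -
  have "h ^ (q - 1) = b / h" "h ^ (q\<^sup>2 - 1) = c / h"
    using q_gt_1 by (simp_all add: b_def c_def frob_def power_diff power_gt1_lemma)
  then show ?thesis
    by (simp add: f_poly_def frob_def)
qed

text \<open>The equation \<open>f(x) = m x\<close> and its third conjugate are two equations in the two expressions
  \<open>b x\<^sub>1 + h x\<^sub>4\<close> and \<open>c x\<^sub>2 - h x\<^sub>5\<close>. Their determinant is, up to a nonzero factor, \<open>b + c\<close>,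
  so both expressions can be solved for in terms of \<open>x\<close> and \<open>x\<^sub>3\<close>.\<close>
lemma eigen_relations:
  assumes "f_poly q h x = m * x"
  shows "(b + c) * (b * fr 1 x + h * fr 4 x) = b * (m * h * x + fr 3 m * c * fr 3 x)"
    and "(b + c) * (c * fr 2 x - h * fr 5 x) = c * (fr 3 m * b * fr 3 x - m * h * x)"
proof -
  have 1: "b * fr 1 x - c * fr 2 x + h * fr 4 x + h * fr 5 x = m * h * x"
    using assms by (simp add: f_poly_eq field_simps)
  have "fr 3 (b * fr 1 x - c * fr 2 x + h * fr 4 x + h * fr 5 x) = fr 3 (m * h * x)"
    using 1 by (rule arg_cong)
  then have "h * (h * c * fr 4 x - h * b * fr 5 x + b * c * (fr 1 x + fr 2 x)) = h * (b * c * fr 3 m * fr 3 x)"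
    by (simp add: fr_h field_simps)
  then have 2: "h * c * fr 4 x - h * b * fr 5 x + b * c * (fr 1 x + fr 2 x) = b * c * fr 3 m * fr 3 x"
    by simp
  show "(b + c) * (b * fr 1 x + h * fr 4 x) = b * (m * h * x + fr 3 m * c * fr 3 x)"
    using 1 2 by algebra
  show "(b + c) * (c * fr 2 x - h * fr 5 x) = c * (fr 3 m * b * fr 3 x - m * h * x)"
    using 1 2 by algebra
qed

text \<open>The conjugate of the second relation is another equation between \<open>(x, x\<^sub>3)\<close> and \<open>(x\<^sub>1, x\<^sub>4)\<close>.\<close>
lemma eigen_relation_shifted:
  assumes "f_poly q h x = m * x"
  shows "(h * c - 1) * (h * b * x + fr 3 x) = h * (fr 4 m * c * fr 4 x - fr 1 m * b * fr 1 x)"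
proof -
  have "fr 1 ((b + c) * (c * fr 2 x - h * fr 5 x)) = fr 1 (c * (fr 3 m * b * fr 3 x - m * h * x))"
    using eigen_relations(2)[OF assms] by (rule arg_cong)
  then have "h * h * ((h * c - 1) * (h * b * x + fr 3 x)) = h * h * (h * (fr 4 m * c * fr 4 x - fr 1 m * b * fr 1 x))"
    by (simp add: fr_h field_simps)
  then show ?thesis by simp
qed

text \<open>The scatteredness of \<open>f\<close>. The element \<open>w = x y\<^sub>3 - y x\<^sub>3\<close> is the determinant of the two
  solutions with respect to the coordinates \<open>(z, z\<^sub>3)\<close>, and \<open>w\<^sub>1\<close> is the one with
  respect to \<open>(z\<^sub>1, z\<^sub>4)\<close>; it vanishes exactly if \<open>y/x\<close> lies in the field with \<open>q ^ 3\<close>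
  elements. The two linear relations between these coordinate pairs have determinants
  that are, up to explicit factors, \<open>D\<close> and \<open>D\<^sub>1\<close> for \<open>D = b c m\<^sub>3 - m\<close>, which gives a relation
  between \<open>D w\<close> and its conjugate.\<close>
lemma eigenvectors_proportional:
  assumes x: "f_poly q h x = m * x" "x \<noteq> 0" and y: "f_poly q h y = m * y"
  shows "fr 1 (y / x) = y / x"
proof (cases "x * fr 3 y = y * fr 3 x")
  case True
  define l where "l = y / x"
  have y_eq: "y = l * x" using x by (simp add: l_def)
  have l3: "fr 3 l = l" using True x by (simp add: l_def field_simps)
  have l4: "fr 4 l = fr 1 l" "fr 5 l = fr 2 l"
    using arg_cong[OF l3, of "fr 1"] arg_cong[OF l3, of "fr 2"] by simp_all
  define P where "P = b * fr 1 x + h * fr 4 x"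
  define Q where "Q = c * fr 2 x - h * fr 5 x"
  have "(b + c) * (fr 1 l * P) = (b + c) * (l * P)"
    using eigen_relations(1)[OF x(1)] eigen_relations(1)[OF y]
    unfolding y_eq frob_mult l3 l4 P_def by algebra
  then have P: "fr 1 l = l \<or> P = 0" using b_plus_c by auto
  have "(b + c) * (fr 2 l * Q) = (b + c) * (l * Q)"
    using eigen_relations(2)[OF x(1)] eigen_relations(2)[OF y]
    unfolding y_eq frob_mult l3 l4 Q_def by algebra
  then have Q: "fr 2 l = l \<or> Q = 0" using b_plus_c by auto
  have "fr 1 l = l"
  proof (rule ccontr)
    assume n: "fr 1 l \<noteq> l"
    have "fr 2 l \<noteq> l"
    proof
      assume "fr 2 l = l"
      then have "fr 1 (fr 2 l) = fr 1 l" by simp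
      then show False using l3 n by simp
    qed
    then have "P = 0" "Q = 0" using n P Q by auto
    then have "fr 1 P = 0" by simp
    then have "c * fr 2 x + b * fr 5 x = 0" by (simp add: P_def fr_h)
    then have "(h + b) * fr 5 x = 0" using \<open>Q = 0\<close> unfolding Q_def by algebra
    then show False using h_plus_b x by simp
  qed
  then show ?thesis by (simp add: l_def)
next
  case False
  have fr_3_k: "fr 3 (b + c) = - (b + c) / (b * c)" by (simp add: fr_h field_simps)
  define w where "w = x * fr 3 y - y * fr 3 x"
  define D where "D = b * c * fr 3 m - m"
  have w: "w \<noteq> 0" using False by (simp add: w_def)
  have w1: "fr 1 w = fr 1 x * fr 4 y - fr 1 y * fr 4 x" and w3: "fr 3 w = - w"
    by (simp_all add: w_def)
  have D1: "h * fr 1 D = - (c * fr 4 m + h * fr 1 m)" and D3: "b * c * fr 3 D = - D"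
    by (simp_all add: D_def fr_h field_simps)
  define P where "P z = b * fr 1 z + h * fr 4 z" for z
  define R where "R z = c * fr 4 m * fr 4 z - b * fr 1 m * fr 1 z" for z
  define S where "S z = h * b * z + fr 3 z" for z
  define U where "U z = m * h * z + fr 3 m * c * fr 3 z" for z
  have PU: "(b + c) * P z = b * U z" if "f_poly q h z = m * z" for z
    using eigen_relations(1)[OF that] by (simp add: P_def U_def)
  have SR: "(h * c - 1) * S z = h * R z" if "f_poly q h z = m * z" for z
    using eigen_relation_shifted[OF that] by (simp add: S_def R_def mult_ac)
  have "((b + c) * P x) * (h * R y) - ((b + c) * P y) * (h * R x)
      = (b * U x) * ((h * c - 1) * S y) - (b * U y) * ((h * c - 1) * S x)"
    by (simp only: PU SR x(1) y)
  moreover have "P x * R y - P y * R x = b * (c * fr 4 m + h * fr 1 m) * fr 1 w"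
    unfolding w1 P_def R_def by algebra
  moreover have "U x * S y - U y * S x = - h * D * w"
    unfolding U_def S_def D_def w_def by algebra
  ultimately have "(b + c) * (c * fr 4 m + h * fr 1 m) * fr 1 w * (h * b) = - (h * c - 1) * D * w * (h * b)"
    by algebra
  then have "(b + c) * (c * fr 4 m + h * fr 1 m) * fr 1 w = - (h * c - 1) * D * w"
    by simp
  then have "(b + c) * (h * fr 1 D) * fr 1 w = (h * c - 1) * D * w"
    using D1 by algebra
  \<comment> \<open>\<open>h c - 1\<close> is \<open>h\<close> times the conjugate of \<open>b + c\<close>, so the last equation says that \<open>T\<close>
    equals its own conjugate.\<close>
  define T where "T = D * w / (b + c)"
  have "h * c - 1 \<noteq> 0" using hc_neq_1 by simp
  have "fr 1 T = T"
    using \<open>(b + c) * (h * fr 1 D) * fr 1 w = (h * c - 1) * D * w\<close> b_plus_c \<open>h * c - 1 \<noteq> 0\<close>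
    by (simp add: T_def fr_h divide_simps) (simp add: algebra_simps)
  then have "fr 1 (fr 1 (fr 1 T)) = T" by simp
  then have "fr 3 T = T" by simp
  moreover have "fr 3 T = - T"
  proof -
    have "fr 3 T = (b * c * fr 3 D) * fr 3 w / - (b + c)"
      unfolding T_def frob_divide frob_mult fr_3_k by simp
    also have "\<dots> = - T"
      by (simp only: T_def D3 w3 minus_mult_minus minus_divide_right)
    finally show ?thesis .
  qed
  ultimately have "2 * T = 0" by (metis add.right_inverse mult_2)
  then have "T = 0" using two_nonzero by simp
  then have "D = 0" using w b_plus_c by (simp add: T_def)
  then have m: "b * c * fr 3 m = m" by (simp add: D_def)
  have "fr 1 D = 0" using \<open>D = 0\<close> by simp
  then have m1: "c * fr 4 m = - h * fr 1 m" using D1 by algebra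
  \<comment> \<open>With \<open>D = 0\<close> both relations involve only the expressions \<open>S\<close> and \<open>P\<close>, and each is a
    multiple of the other.\<close>
  have key: "((b + c) * (h * c - 1) + h * m * fr 1 m) * S z = 0" if z: "f_poly q h z = m * z" for z
  proof -
    have "(b + c) * P z = m * S z"
      using PU[OF z] m unfolding S_def U_def by algebra
    moreover have "(h * c - 1) * S z = - h * fr 1 m * P z"
      using SR[OF z] m1 unfolding R_def P_def by algebra
    ultimately show ?thesis by algebra
  qed
  have "S x \<noteq> 0 \<or> S y \<noteq> 0"
  proof (rule ccontr)
    assume "\<not> (S x \<noteq> 0 \<or> S y \<noteq> 0)"
    then have "fr 3 x = - (h * b * x)" "fr 3 y = - (h * b * y)"
      by (auto simp: S_def eq_neg_iff_add_eq_0 add.commute)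
    then show False using w by (simp add: w_def)
  qed
  then have mm: "(b + c) * (h * c - 1) + h * m * fr 1 m = 0"
    using key[OF x(1)] key[OF y] by auto
  \<comment> \<open>\<open>g g\<^sub>1 = -1\<close> implies \<open>g\<^sub>2 = g\<close>, so \<open>g\<^sub>3 = g\<^sub>1\<close>; with \<open>g\<^sub>3 = -g\<close> this gives \<open>g\<^sup>2 = 1\<close>, so \<open>g\<close> is fixed
    by the Frobenius map and equals \<open>-g\<close>.\<close>
  define g where "g = m / (b + c)"
  have g1: "g * fr 1 g = -1"
    using mm b_plus_c \<open>h * c - 1 \<noteq> 0\<close>
    by (simp add: g_def fr_h divide_simps) (simp add: algebra_simps)
  have g3: "fr 3 g = - g"
  proof -
    have "fr 3 g = (b * c * fr 3 m) / - (b + c)"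
      unfolding g_def frob_divide fr_3_k by simp
    also have "\<dots> = - g"
      by (simp only: g_def m minus_divide_right)
    finally show ?thesis .
  qed
  have "g \<noteq> 0" using g1 by auto
  have "fr 1 g * fr 2 g = -1" using arg_cong[OF g1, of "fr 1"] by simp
  then have "fr 1 g * fr 2 g = fr 1 g * g" using g1 by (simp add: mult.commute)
  then have "fr 2 g = g" using \<open>g \<noteq> 0\<close> by simp
  then have "fr 1 (fr 2 g) = fr 1 g" by simp
  then have "fr 1 g = - g" using g3 by simp
  then have "g * g = 1" using g1 by simp
  then have "g = 1 \<or> g = -1" by (simp add: square_eq_1_iff)
  then have "fr 1 g = g" by auto
  then have "2 * g = 0" using \<open>fr 1 g = - g\<close> by (metis add.right_inverse mult_2)
  then have False using \<open>g \<noteq> 0\<close> two_nonzero by (simp only: mult_eq_0_iff) simp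
  then show ?thesis ..
qed

lemma fr_f:
  "fr 1 (f_poly q h y) = c / b * fr 2 y + 1 / (h * b) * fr 3 y + fr 5 y + y"
  "fr 2 (f_poly q h y) = - 1 / (h * c) * fr 3 y + 1 / (b * c) * fr 4 y + y + fr 1 y"
  "fr 3 (f_poly q h y) = h / b * fr 4 y - h / c * fr 5 y + fr 1 y + fr 2 y"
  "fr 4 (f_poly q h y) = b / c * fr 5 y + h * b * y + fr 2 y + fr 3 y"
  "fr 5 (f_poly q h y) = - (h * c) * y + b * c * fr 1 y + fr 3 y + fr 4 y"
  by (simp_all add: f_poly_eq fr_h field_simps)

text \<open>Wherever \<open>e\<close> names the conclusions of this rule, \<open>e(i + 1)\<close> compares the coefficients
  of \<open>x\<^sub>i\<close>.\<close>
lemmas coeffs_eq = frob_coeffs_eq[OF card_l q_gt_1]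

text \<open>The left side has the coefficient \<open>\<alpha>\<^sub>1 / (h b)\<close> at \<open>x\<^sub>3\<close>, where \<open>f\<close> has none.\<close>
lemma pseudoregulus_composition:
  assumes H: "\<And>y. fr 1 (\<alpha> * f_poly q h y + \<beta> * y) = \<alpha>' * f_poly q h y + \<beta>' * y"
  shows "\<alpha> = 0 \<and> \<beta> = 0"
proof -
  let ?X = "fr 1 \<alpha>"
  have "?X * y + fr 1 \<beta> * fr 1 y + ?X * (c / b) * fr 2 y + ?X * (1 / (h * b)) * fr 3 y + 0 * fr 4 y + ?X * fr 5 y
    = \<beta>' * y + \<alpha>' * (b / h) * fr 1 y + - \<alpha>' * (c / h) * fr 2 y + 0 * fr 3 y + \<alpha>' * fr 4 y + \<alpha>' * fr 5 y" for y
    using H[of y] unfolding fr_add frob_mult fr_f unfolding f_poly_eq by (simp add: algebra_simps)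
  note e = coeffs_eq[OF this]
  from e(4) have "\<alpha> = 0" by simp
  with e(2,5) show ?thesis by simp
qed

text \<open>The coefficients of \<open>x\<^sub>2\<close>, \<open>x\<^sub>3\<close> and \<open>x\<^sub>4\<close> force \<open>h\<^sup>2 = 1\<close> if \<open>\<alpha> \<noteq> 0\<close>; then \<open>h\<close> is fixed by
  the Frobenius map and the norm condition reads \<open>h\<^sup>2 = -1\<close>.\<close>
lemma lunardon_polverino_composition:
  assumes H: "\<And>y. \<delta> * fr 1 (\<alpha> * f_poly q h y + \<beta> * y) + fr 5 (\<alpha> * f_poly q h y + \<beta> * y)
      = \<alpha>' * f_poly q h y + \<beta>' * y" and d: "\<delta> \<noteq> 0"
  shows "\<alpha> = 0 \<and> \<beta> = 0"
proof -
  let ?X = "\<delta> * fr 1 \<alpha>" and ?Z = "fr 5 \<alpha>"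
  have "(?X - ?Z * (h * c)) * y + (?Z * (b * c) + \<delta> * fr 1 \<beta>) * fr 1 y + ?X * (c / b) * fr 2 y
      + (?X * (1 / (h * b)) + ?Z) * fr 3 y + ?Z * fr 4 y + (?X + fr 5 \<beta>) * fr 5 y
    = \<beta>' * y + \<alpha>' * (b / h) * fr 1 y + - \<alpha>' * (c / h) * fr 2 y + 0 * fr 3 y + \<alpha>' * fr 4 y + \<alpha>' * fr 5 y" for y
    using H[of y] unfolding fr_add frob_mult fr_f unfolding f_poly_eq by (simp add: algebra_simps)
  note e = coeffs_eq[OF this]
  have Z: "?Z = \<alpha>'" using e(5) by simp
  have "c * (h * ?X) = c * (- b * ?Z)" using e(3) unfolding Z by (simp add: field_simps)
  then have 1: "h * ?X = - b * ?Z" by (simp only: mult_cancel_left) simp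
  have 2: "?X = - h * b * ?Z" using e(4) by (simp add: field_simps eq_neg_iff_add_eq_0)
  have "?Z = 0"
  proof (rule ccontr)
    assume "?Z \<noteq> 0"
    have "b * ?Z * (h * h) = b * ?Z * 1" using 1 2 by algebra
    then have hh: "h * h = 1" using \<open>?Z \<noteq> 0\<close> by simp
    then have "h = 1 \<or> h = -1" by (simp add: square_eq_1_iff)
    then have "h = b" using fr_h(1) by auto
    moreover have "c = b" using \<open>h = b\<close> fr_h(6) fr_h(1) by simp
    moreover have "- 1 / h = h" using fr_h(11) fr_h(1) \<open>c = b\<close> \<open>h = b\<close> by simp
    then have "h * h = -1" by (simp add: field_simps)
    then have "(2::'l) = 0" using hh by simp
    then show False using two_nonzero by simp
  qed
  then have "\<alpha> = 0" by simp
  with e(2,5) show ?thesis using d by simp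
qed

text \<open>The coefficients of \<open>x\<^sub>2\<close>, \<open>x\<^sub>3\<close> and \<open>x\<^sub>5\<close> are incompatible with \<open>\<alpha> \<noteq> 0\<close>, because \<open>h + b\<close> and
  \<open>h c - 1\<close> are nonzero.\<close>
lemma binomial_composition:
  assumes H: "\<And>y. fr 1 (\<alpha> * f_poly q h y + \<beta> * y) + \<delta> * fr 4 (\<alpha> * f_poly q h y + \<beta> * y)
      = \<alpha>' * f_poly q h y + \<beta>' * y"
  shows "\<alpha> = 0 \<and> \<beta> = 0"
proof -
  let ?X = "fr 1 \<alpha>" and ?Z = "\<delta> * fr 4 \<alpha>"
  have "(?X + ?Z * (h * b)) * y + fr 1 \<beta> * fr 1 y + (?X * (c / b) + ?Z) * fr 2 y
      + (?X * (1 / (h * b)) + ?Z) * fr 3 y + \<delta> * fr 4 \<beta> * fr 4 y + (?X + ?Z * (b / c)) * fr 5 y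
    = \<beta>' * y + \<alpha>' * (b / h) * fr 1 y + - \<alpha>' * (c / h) * fr 2 y + 0 * fr 3 y + \<alpha>' * fr 4 y + \<alpha>' * fr 5 y" for y
    using H[of y] unfolding fr_add frob_mult fr_f unfolding f_poly_eq by (simp add: algebra_simps)
  note e = coeffs_eq[OF this]
  have 1: "?X = - h * b * ?Z" using e(4) by (simp add: field_simps eq_neg_iff_add_eq_0)
  have 2: "h * (c * ?X + b * ?Z) = - b * c * \<alpha>'" using e(3) by (simp add: field_simps)
  have 3: "c * ?X + b * ?Z = c * \<alpha>'" using e(6) by (simp add: field_simps)
  have "b * ?Z * ((h + b) * (h * c - 1)) = 0" using 1 2 3 by algebra
  then have Z: "?Z = 0" using h_plus_b hc_neq_1 by simp
  then have "?X = 0" using 1 by (simp del: fr_eq_0_iff)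
  then have "\<alpha> = 0" by simp
  with 3 e(2) show ?thesis by simp
qed

text \<open>The coefficient of \<open>x\<^sub>3\<close> must vanish, which puts \<open>\<alpha>\<close> among the roots of an additive
  polynomial; for \<open>\<alpha> = 0\<close> the remaining coefficients force the conjugates of \<open>\<beta>\<close> to agree.\<close>
lemma right_idealiser_coeff:
  assumes H: "\<And>y. f_poly q h (\<alpha> * f_poly q h y + \<beta> * y) = \<alpha>' * f_poly q h y + \<beta>' * y"
  shows "fr 1 \<alpha> + fr 2 \<alpha> + h\<^sup>2 * (fr 4 \<alpha> + fr 5 \<alpha>) = 0"
    and "\<alpha> = 0 \<Longrightarrow> fr 1 \<beta> = \<beta>"
proof -
  let ?X = "b / h * fr 1 \<alpha>" and ?Y = "c / h * fr 2 \<alpha>" and ?U = "fr 4 \<alpha>" and ?V = "fr 5 \<alpha>"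
  have "(?X - ?Y + ?U * (h * b) - ?V * (h * c)) * y + (?V * (b * c) - ?Y + b / h * fr 1 \<beta>) * fr 1 y
      + (?X * (c / b) + ?U - c / h * fr 2 \<beta>) * fr 2 y
      + (?X * (1 / (h * b)) + ?Y * (1 / (h * c)) + ?U + ?V) * fr 3 y + (?V - ?Y * (1 / (b * c)) + fr 4 \<beta>) * fr 4 y
      + (?X + ?U * (b / c) + fr 5 \<beta>) * fr 5 y
    = \<beta>' * y + \<alpha>' * (b / h) * fr 1 y + - \<alpha>' * (c / h) * fr 2 y + 0 * fr 3 y + \<alpha>' * fr 4 y + \<alpha>' * fr 5 y" for y
    using H[of y] unfolding f_poly_eq[of "\<alpha> * f_poly q h y + \<beta> * y"] fr_add frob_mult fr_f
    unfolding f_poly_eq by (simp add: algebra_simps)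
  note e = coeffs_eq[OF this]
  show "fr 1 \<alpha> + fr 2 \<alpha> + h\<^sup>2 * (fr 4 \<alpha> + fr 5 \<alpha>) = 0"
    using e(4) by (simp add: field_simps power2_eq_square)
  assume "\<alpha> = 0"
  then have "fr 1 \<beta> = \<alpha>'" "fr 2 \<beta> = \<alpha>'" using e(2,3) by simp_all
  then have "fr 1 (fr 1 \<beta>) = fr 1 \<beta>" unfolding frob_frob by simp
  then show "fr 1 \<beta> = \<beta>" by (simp only: fr_eq_iff)
qed

text \<open>With \<open>X = \<alpha>\<^sub>1\<close>, \<open>Y = \<alpha>\<^sub>3\<close>, \<open>Z = \<alpha>\<^sub>5\<close>, eliminating \<open>\<alpha>'\<close> and \<open>\<beta>\<close> gives \<open>X = (\<delta> - b/c) Y\<close> and,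
  by the second Frobenius power, which fixes \<open>\<delta>\<close>, the relations \<open>Y = (\<delta> - b/h) Z\<close> and
  \<open>Z = (\<delta> + 1/(h c)) X\<close>. Their product is one equation for \<open>h\<close>; the coefficients of \<open>x\<^sub>2\<close>
  and \<open>x\<^sub>4\<close> give another. Both have the factor \<open>(\<delta> c - b) (\<delta> h - b)\<close> on the left and \<open>(h c)\<^sup>2\<close> on
  the right, and comparing them yields \<open>h c = -1\<close>, that is \<open>h\<^sub>2 = h\<^sub>3\<close>. So \<open>h\<close> is fixed by the
  Frobenius map, \<open>h\<^sup>2 = -1\<close>, and either equation becomes an equation for \<open>\<delta>\<close> alone that
  contradicts \<open>\<delta>\<^sup>2 + \<delta> = 1\<close> unless \<open>5 = 0\<close>.\<close>
lemma trinomial_composition: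
  assumes H: "\<And>y. fr 1 (\<alpha> * f_poly q h y + \<beta> * y) + fr 3 (\<alpha> * f_poly q h y + \<beta> * y)
      + \<delta> * fr 5 (\<alpha> * f_poly q h y + \<beta> * y) = \<alpha>' * f_poly q h y + \<beta>' * y"
    and d: "\<delta>\<^sup>2 + \<delta> = 1" and nz: "\<alpha> \<noteq> 0 \<or> \<beta> \<noteq> 0"
  shows "fr 1 h = h \<and> (5::'l) = 0"
proof -
  let ?X = "fr 1 \<alpha>" and ?Y = "fr 3 \<alpha>" and ?Z = "fr 5 \<alpha>"
  have d2: "fr 2 \<delta> = \<delta>"
  proof -
    have "(fr 1 \<delta>)\<^sup>2 + fr 1 \<delta> = 1" using arg_cong[OF d, of "fr 1"] by simp
    then have "(fr 1 \<delta> - \<delta>) * (fr 1 \<delta> + \<delta> + 1) = 0" using d by algebra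
    then have "fr 1 \<delta> - \<delta> = 0 \<or> fr 1 \<delta> + \<delta> + 1 = 0" by (rule mult_eq_0_iff[THEN iffD1])
    then have "fr 1 (fr 1 \<delta>) = \<delta>"
    proof
      assume "fr 1 \<delta> + \<delta> + 1 = 0"
      then have "fr 1 (fr 1 \<delta> + \<delta> + 1) = fr 1 \<delta> + \<delta> + 1" by simp
      then show ?thesis by (simp del: frob_frob)
    qed simp
    then show ?thesis by simp
  qed
  have "(?X - \<delta> * ?Z * (h * c)) * y + (?Y + \<delta> * ?Z * (b * c) + fr 1 \<beta>) * fr 1 y + (?X * (c / b) + ?Y) * fr 2 y
      + (?X * (1 / (h * b)) + \<delta> * ?Z + fr 3 \<beta>) * fr 3 y + (?Y * (h / b) + \<delta> * ?Z) * fr 4 y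
      + (?X - ?Y * (h / c) + \<delta> * fr 5 \<beta>) * fr 5 y
    = \<beta>' * y + \<alpha>' * (b / h) * fr 1 y + - \<alpha>' * (c / h) * fr 2 y + 0 * fr 3 y + \<alpha>' * fr 4 y + \<alpha>' * fr 5 y" for y
    using H[of y] unfolding fr_add frob_mult fr_f unfolding f_poly_eq by (simp add: algebra_simps)
  note e = coeffs_eq[OF this]
  have e1: "h * (?Y + \<delta> * ?Z * (b * c) + fr 1 \<beta>) = \<alpha>' * b" using e(2) by (simp add: field_simps)
  have e2: "h * (?X * c + ?Y * b) = - \<alpha>' * c * b" using e(3) by (simp add: field_simps)
  have e4: "?Y * h + \<delta> * ?Z * b = \<alpha>' * b" using e(5) by (simp add: field_simps)
  have e5: "?X * c - ?Y * h + \<delta> * fr 5 \<beta> * c = \<alpha>' * c" using e(6) by (simp add: field_simps)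
  have "\<alpha> \<noteq> 0"
  proof
    assume "\<alpha> = 0"
    then have "\<alpha>' = 0" "fr 1 \<beta> = 0" using e4 e1 by simp_all
    then show False using nz \<open>\<alpha> = 0\<close> by simp
  qed
  have B1: "c * fr 1 \<beta> = (h * c - 1) * (c * ?X + (b + c) * ?Y)"
  proof -
    have "h * b * (c * fr 1 \<beta>) = h * b * ((h * c - 1) * (c * ?X + (b + c) * ?Y))"
      using e1 e2 e4 by algebra
    then show ?thesis by (simp del: fr_eq_0_iff)
  qed
  \<comment> \<open>The coefficients of \<open>x\<^sub>2\<close> and \<open>x\<^sub>5\<close> express \<open>\<beta>\<^sub>5\<close> by \<open>X\<close>; its second conjugate expresses \<open>\<beta>\<^sub>1\<close>
    by \<open>Y\<close>, to be compared with the value of \<open>\<beta>\<^sub>1\<close> just found.\<close>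
  have "c * (\<delta> * fr 5 \<beta> * b) = c * (- (h + b) * ?X)"
    using e2 e5 by algebra
  then have "\<delta> * fr 5 \<beta> * b = - (h + b) * ?X" by (simp only: mult_cancel_left) simp
  then have "fr 2 (\<delta> * fr 5 \<beta> * b) = fr 2 (- (h + b) * ?X)" by (rule arg_cong)
  then have B1': "\<delta> * fr 1 \<beta> = (h * c - 1) * ?Y" by (simp add: d2 fr_h field_simps)
  have "(h * c - 1) * (c * ?X) = (h * c - 1) * ((\<delta> * c - b) * ?Y)"
    using B1 B1' d by algebra
  then have XY: "c * ?X = (\<delta> * c - b) * ?Y" using hc_neq_1 by simp
  have "fr 2 (c * ?X) = fr 2 ((\<delta> * c - b) * ?Y)" using XY by (rule arg_cong)
  then have YZ: "h * ?Y = (\<delta> * h - b) * ?Z" by (simp add: d2 fr_h field_simps)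
  have "fr 2 (h * ?Y) = fr 2 ((\<delta> * h - b) * ?Z)" using YZ by (rule arg_cong)
  then have ZX: "h * c * ?Z = (\<delta> * h * c + 1) * ?X" by (simp add: d2 fr_h field_simps)
  have "b * (b * c * \<delta> * ?Z) = b * (- (h * c * ?X) - h * (b + c) * ?Y)" using e2 e4 by algebra
  then have "b * c * \<delta> * ?Z = - (h * c * ?X) - h * (b + c) * ?Y" by (simp only: mult_cancel_left) simp
  then have "fr 2 (b * c * \<delta> * ?Z) = fr 2 (- (h * c * ?X) - h * (b + c) * ?Y)" by (rule arg_cong)
  then have X: "\<delta> * ?X = h * c * ?Y + c * (h + b) * ?Z" by (simp add: d2 fr_h field_simps)
  have "?Z \<noteq> 0" using \<open>\<alpha> \<noteq> 0\<close> by simp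
  have "((\<delta> * h * c + 1) * (\<delta> * c - b) * (\<delta> * h - b)) * ?Z = (h * c)\<^sup>2 * ?Z"
    using XY YZ ZX by algebra
  then have N: "(\<delta> * h * c + 1) * (\<delta> * c - b) * (\<delta> * h - b) = (h * c)\<^sup>2"
    using \<open>?Z \<noteq> 0\<close> by (simp only: mult_cancel_right) simp
  have "(\<delta>\<^sup>2 * (\<delta> * c - b) * (\<delta> * h - b)) * ?Z = (h * c)\<^sup>2 * ?Z"
    using XY YZ X d by algebra
  then have M: "\<delta>\<^sup>2 * (\<delta> * c - b) * (\<delta> * h - b) = (h * c)\<^sup>2"
    using \<open>?Z \<noteq> 0\<close> by (simp only: mult_cancel_right) simp
  have "(\<delta> * h * c + 1 - \<delta>\<^sup>2) * (h * c)\<^sup>2 = 0" using N M by algebra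
  then have "\<delta> * h * c + 1 - \<delta>\<^sup>2 = 0" by simp
  then have "\<delta> * (h * c) = \<delta> * (-1)" using d by algebra
  moreover have "\<delta> \<noteq> 0" using d by auto
  ultimately have hc: "h * c = -1" by (simp only: mult_cancel_left) simp
  then have "fr 2 h = fr 2 b" by (simp add: fr_h field_simps)
  then have hb: "b = h" by (simp only: fr_eq_iff)
  then have hcc: "c = h" using fr_h(6) fr_h(1) by simp
  have "\<delta>\<^sup>2 * (\<delta> - 1)\<^sup>2 * h\<^sup>2 = (h\<^sup>2)\<^sup>2" using M unfolding hb hcc by algebra
  moreover have h2: "h\<^sup>2 = -1" using hc by (simp add: hcc power2_eq_square)
  ultimately have "\<delta>\<^sup>2 * (\<delta> - 1)\<^sup>2 = -1" by algebra
  moreover have "\<delta>\<^sup>2 * (\<delta> - 1)\<^sup>2 = 5 - 8 * \<delta>" using d by algebra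
  ultimately have "2 * (4 * \<delta>) = 2 * 3" by (simp add: algebra_simps)
  then have "4 * \<delta> = 3" using two_nonzero by (simp only: mult_cancel_left) simp
  moreover have "(4 * \<delta>)\<^sup>2 + 4 * (4 * \<delta>) = 16" using d by algebra
  ultimately have "(21::'l) = 16" by simp
  then have "(21::'l) - 16 = 0" by (simp only: diff_self)
  then have "(5::'l) = 0" by simp
  then show ?thesis using hb fr_h(1) by simp
qed

end

section \<open>The codes of the family\<close>

locale f_code = f_family q h + extension_basis \<iota> B
  for q :: nat and h :: "'l::{field,finite}" and \<iota> :: "'k::{field,finite} \<Rightarrow> 'l" and B :: "6 \<Rightarrow> 'l" +
  assumes card_k: "CARD('k) = q"
begin

abbreviation f where "f \<equiv> f_poly q h"
abbreviation code :: "('l \<Rightarrow> 'l) \<Rightarrow> ('k^6^6) set" where "code \<equiv> poly_matrix_code \<iota> B"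

lemma range_\<iota>: "range \<iota> = {x. fr 1 x = x}"
  by (rule range_embedding_eq_fixed[OF embedding card_k q_gt_1])

lemma card_fixed: "card {x::'l. fr 1 x = x} = q"
  using card_image[OF field_embedding_inj[OF embedding]] by (simp add: range_\<iota> card_k)

lemma base_linear_fr: "base_linear (fr i)"
proof -
  have "fr i (\<iota> c) = \<iota> c" for c
  proof (induction i)
    case (Suc i)
    have "fr 1 (\<iota> c) = \<iota> c" using range_\<iota> by auto
    moreover have "fr (Suc i) (\<iota> c) = fr 1 (fr i (\<iota> c))" by (simp only: frob_frob plus_1_eq_Suc)
    ultimately show ?case by (simp only: Suc)
  qed (simp add: frob_def)
  then show ?thesis by (simp add: base_linear_def)
qed

lemma base_linear_f_poly: "base_linear f"
proof -
  have "base_linear (\<lambda>x. b / h * fr 1 x + (- c / h) * fr 2 x + fr 4 x + fr 5 x)"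
    by (intro base_linear_add base_linear_scale base_linear_fr)
  then show ?thesis by (simp add: f_poly_eq[abs_def])
qed

text \<open>A nonzero codeword either is a multiplication, hence injective, or its kernel is a space of
  solutions of \<open>f(z) = m z\<close>, hence lies on one line over the small field.\<close>
lemma card_kernel_le:
  assumes "\<alpha> \<noteq> 0 \<or> \<beta> \<noteq> 0"
  shows "card {x. \<alpha> * f x + \<beta> * x = 0} \<le> q"
proof (cases "{x. \<alpha> * f x + \<beta> * x = 0} \<subseteq> {0}")
  case True
  then have "card {x. \<alpha> * f x + \<beta> * x = 0} \<le> card {0::'l}" by (intro card_mono) auto
  then show ?thesis using q_gt_1 by simp
next
  case False
  then obtain x where x: "x \<noteq> 0" "\<alpha> * f x + \<beta> * x = 0" by auto
  then have "\<alpha> \<noteq> 0" using assms by auto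
  then have eig: "\<alpha> * f y + \<beta> * y = 0 \<longleftrightarrow> f y = (- \<beta> / \<alpha>) * y" for y
    by (auto simp: field_simps eq_neg_iff_add_eq_0)
  have "{x. \<alpha> * f x + \<beta> * x = 0} \<subseteq> (\<lambda>l. l * x) ` {l. fr 1 l = l}"
  proof
    fix y assume "y \<in> {x. \<alpha> * f x + \<beta> * x = 0}"
    then have "fr 1 (y / x) = y / x"
      using x eig by (intro eigenvectors_proportional[of x "- \<beta> / \<alpha>"]) auto
    moreover have "y = (y / x) * x" using x by simp
    ultimately show "y \<in> (\<lambda>l. l * x) ` {l. fr 1 l = l}" by blast
  qed
  then have "card {x. \<alpha> * f x + \<beta> * x = 0} \<le> card {l::'l. fr 1 l = l}"
    by (rule surj_card_le[rotated]) simp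
  then show ?thesis by (simp add: card_fixed)
qed

lemma q_less: "q < q ^ 6"
  using power_strict_increasing[of 1 6 q] q_gt_1 by simp

lemma code_coeffs_unique:
  assumes "\<And>x. \<alpha> * f x + \<beta> * x = \<alpha>' * f x + \<beta>' * x"
  shows "\<alpha> = \<alpha>'" "\<beta> = \<beta>'"
proof -
  have "{x. (\<alpha> - \<alpha>') * f x + (\<beta> - \<beta>') * x = 0} = UNIV"
    using assms by (auto simp: algebra_simps)
  then have "\<not> (\<alpha> - \<alpha>' \<noteq> 0 \<or> \<beta> - \<beta>' \<noteq> 0)"
    using card_kernel_le[of "\<alpha> - \<alpha>'" "\<beta> - \<beta>'"] card_l q_less by auto
  then show "\<alpha> = \<alpha>'" "\<beta> = \<beta>'" by auto
qed

lemma card_code: "card (code f) = q ^ 12"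
proof -
  let ?g = "\<lambda>(\<alpha>, \<beta>). E (\<lambda>x. \<alpha> * f x + \<beta> * x)"
  have lin: "base_linear (\<lambda>x. \<alpha> * f x + \<beta> * x)" for \<alpha> \<beta>
    by (intro base_linear_add base_linear_scale base_linear_f_poly base_linear_mult)
  have "code f = range ?g"
    by (auto simp: poly_matrix_code_def poly_code_def)
  moreover have "inj ?g"
  proof (rule injI, clarify)
    fix \<alpha> \<beta> \<alpha>' \<beta>'
    assume "E (\<lambda>x. \<alpha> * f x + \<beta> * x) = E (\<lambda>x. \<alpha>' * f x + \<beta>' * x)"
    then have "(\<lambda>x. \<alpha> * f x + \<beta> * x) = (\<lambda>x. \<alpha>' * f x + \<beta>' * x)" by (rule E_inj[OF lin lin])
    then show "\<alpha> = \<alpha>' \<and> \<beta> = \<beta>'" using code_coeffs_unique by metis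
  qed
  ultimately have "card (code f) = CARD('l \<times> 'l)"
    by (simp add: card_image)
  then show ?thesis
    by (simp add: card_l flip: power_add)
qed

text \<open>Rank at least 5 comes from kernels having at most \<open>q\<close> elements; the codeword
  \<open>f(x) - f(1) x\<close> attains the bound since it vanishes at 1.\<close>
lemma min_distance_code: "min_distance (code f) 5"
proof -
  have lin: "base_linear (\<lambda>x. \<alpha> * f x + \<beta> * x)" for \<alpha> \<beta>
    by (intro base_linear_add base_linear_scale base_linear_f_poly base_linear_mult)
  have ge: "5 \<le> rank (E (\<lambda>x. \<alpha> * f x + \<beta> * x))" if nz: "\<alpha> \<noteq> 0 \<or> \<beta> \<noteq> 0" for \<alpha> \<beta>
  proof -
    let ?M = "E (\<lambda>x. \<alpha> * f x + \<beta> * x)"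
    have "q ^ 6 \<le> card {v. ?M *v v = 0} * q ^ rank ?M"
      using card_kernel_ge[of ?M] by (simp add: card_k)
    also have "\<dots> \<le> q * q ^ rank ?M"
      using card_kernel_le[OF nz] by (simp add: card_kernel_E[OF lin])
    finally have "q ^ 6 \<le> q ^ Suc (rank ?M)" by simp
    then have "6 \<le> Suc (rank ?M)" by (rule power_le_imp_le_exp[OF q_gt_1])
    then show ?thesis by simp
  qed
  have "5 \<le> rank_dist M N" if MN: "M \<in> code f" "N \<in> code f" "M \<noteq> N" for M N
  proof -
    obtain a d where M: "M = E (\<lambda>x. a * f x + d * x)" using mem_codeE[OF base_linear_f_poly MN(1)] by metis
    obtain a' d' where N: "N = E (\<lambda>x. a' * f x + d' * x)" using mem_codeE[OF base_linear_f_poly MN(2)] by metis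
    have "M - N = E (\<lambda>x. (a * f x + d * x) - (a' * f x + d' * x))"
      unfolding M N by (rule E_diff[symmetric]; rule lin)
    also have "(\<lambda>x. (a * f x + d * x) - (a' * f x + d' * x)) = (\<lambda>x. (a - a') * f x + (d - d') * x)"
      by (auto simp: algebra_simps)
    finally show ?thesis
      using ge[of "a - a'" "d - d'"] MN(3) M N by (auto simp: rank_dist_def)
  qed
  moreover have "\<exists>M\<in>code f. \<exists>N\<in>code f. M \<noteq> N \<and> rank_dist M N = 5"
  proof -
    let ?M = "E (\<lambda>x. 1 * f x + (- f 1) * x)"
    have "?M *v coords 1 = 0"
      using E_works[OF lin, of 1 "- f 1" "coords 1"] by (simp add: lc_0 flip: lc_eq_iff)
    moreover have "coords 1 \<noteq> 0" by (metis lc_0 lc_coords zero_neq_one)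
    ultimately have "rank ?M < 6" using rank_less_if_kernel[of ?M "coords 1"] by simp
    moreover have "5 \<le> rank ?M" by (rule ge) simp
    ultimately have "rank ?M = 5" by simp
    moreover have "?M \<noteq> 0"
    proof
      assume "?M = 0"
      then have "E (\<lambda>x. 1 * f x + (- f 1) * x) = E (\<lambda>x. 0 * f x + 0 * x)" by (simp add: E_zero)
      then have "(\<lambda>x. 1 * f x + (- f 1) * x) = (\<lambda>x. 0 * f x + 0 * x)" by (rule E_inj[OF lin lin])
      then have "(1::'l) = 0" by (intro code_coeffs_unique(1)[of 1 "- f 1" 0 0]) (rule fun_cong)
      then show False by simp
    qed
    moreover have "?M \<in> code f" unfolding poly_matrix_code_def poly_code_def by blast
    moreover have "0 \<in> code f"
      unfolding poly_matrix_code_def E_zero[symmetric]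
      by (intro imageI) (auto simp: poly_code_def intro!: exI[of _ 0])
    ultimately show ?thesis by (intro bexI[of _ ?M] bexI[of _ 0]) (auto simp: rank_dist_def)
  qed
  ultimately show ?thesis by (simp add: min_distance_def)
qed

text \<open>An element of the left idealiser is a codeword \<open>\<alpha> f(x) + \<beta> x\<close>, because the identity is one.
  Composing it with the multiplication by \<open>\<gamma>\<close> and comparing the coefficients of \<open>x\<^sub>4\<close> and \<open>x\<^sub>5\<close>
  gives \<open>\<alpha> \<gamma>\<^sub>4 = \<alpha> \<gamma>\<^sub>5\<close> for every \<open>\<gamma>\<close>, so \<open>\<alpha> = 0\<close>.\<close>
lemma left_idealiser_code: "left_idealiser (code f) = range (\<lambda>\<beta>. E (\<lambda>x. \<beta> * x))"
proof
  show "range (\<lambda>\<beta>. E (\<lambda>x. \<beta> * x)) \<subseteq> left_idealiser (code f)"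
    using mult_mem_left_idealiser[OF base_linear_f_poly] by auto
  show "left_idealiser (code f) \<subseteq> range (\<lambda>\<beta>. E (\<lambda>x. \<beta> * x))"
  proof
    fix M assume M: "M \<in> left_idealiser (code f)"
    then have "M ** mat 1 \<in> code f" using id_mem_code unfolding left_idealiser_def by blast
    then obtain \<alpha> \<beta> where M_eq: "M = E (\<lambda>x. \<alpha> * f x + \<beta> * x)" and lin: "base_linear (\<lambda>x. \<alpha> * f x + \<beta> * x)"
      using mem_codeE[OF base_linear_f_poly, of M] by auto
    have "\<alpha> = 0"
    proof (rule ccontr)
      assume "\<alpha> \<noteq> 0"
      have "fr 1 \<gamma> = \<gamma>" for \<gamma> :: 'l
      proof -
        have "E (\<lambda>x. \<gamma> * x) \<in> code f"
          by (subst E_mem_code_iff[OF base_linear_f_poly base_linear_mult]) (auto intro: exI[of _ 0])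
        then have "E ((\<lambda>x. \<alpha> * f x + \<beta> * x) \<circ> (\<lambda>x. \<gamma> * x)) \<in> code f"
          using M unfolding M_eq left_idealiser_def E_comp[OF lin base_linear_mult] by blast
        then obtain \<alpha>' \<beta>' where H: "\<And>x. \<alpha> * f (\<gamma> * x) + \<beta> * (\<gamma> * x) = \<alpha>' * f x + \<beta>' * x"
          unfolding E_mem_code_iff[OF base_linear_f_poly base_linear_comp[OF lin base_linear_mult]] by auto
        have "\<beta> * \<gamma> * x + \<alpha> * (b / h) * fr 1 \<gamma> * fr 1 x + - \<alpha> * (c / h) * fr 2 \<gamma> * fr 2 x
              + 0 * fr 3 x + \<alpha> * fr 4 \<gamma> * fr 4 x + \<alpha> * fr 5 \<gamma> * fr 5 x
            = \<beta>' * x + \<alpha>' * (b / h) * fr 1 x + - \<alpha>' * (c / h) * fr 2 x + 0 * fr 3 x + \<alpha>' * fr 4 x + \<alpha>' * fr 5 x" for x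
          using H[of x] unfolding f_poly_eq by (simp add: algebra_simps)
        note e = coeffs_eq[OF this]
        have "\<alpha> * fr 4 \<gamma> = \<alpha> * fr 5 \<gamma>" using e(5,6) by simp
        then have "fr 4 (fr 1 \<gamma>) = fr 4 \<gamma>" using \<open>\<alpha> \<noteq> 0\<close> by simp
        then show "fr 1 \<gamma> = \<gamma>" by (simp only: fr_eq_iff)
      qed
      then have "{x::'l. fr 1 x = x} = UNIV" by auto
      then show False using card_fixed card_l q_less by simp
    qed
    then show "M \<in> range (\<lambda>\<beta>. E (\<lambda>x. \<beta> * x))" by (auto simp: M_eq)
  qed
qed

lemma matrix_ring_iso_left_idealiser:
  "matrix_ring_iso (\<lambda>\<beta>. E (\<lambda>x. \<beta> * x)) (left_idealiser (code f))"
proof -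
  have "E (\<lambda>z. (x + y) * z) = E (\<lambda>z. x * z) + E (\<lambda>z. y * z)" for x y
    using E_add[OF base_linear_mult base_linear_mult, of x y] by (simp add: distrib_right)
  moreover have "E (\<lambda>z. (x * y) * z) = E (\<lambda>z. x * z) ** E (\<lambda>z. y * z)" for x y
    using E_comp[OF base_linear_mult base_linear_mult, of x y] by (simp add: o_def mult.assoc)
  moreover have "(*) (1::'l) = (\<lambda>x. x)" by auto
  moreover have "inj (\<lambda>\<beta>. E (\<lambda>x. \<beta> * x))"
    using mult_E_inj by (auto simp: inj_def)
  ultimately show ?thesis
    by (simp add: matrix_ring_iso_def left_idealiser_code bij_betw_def E_id)
qed

text \<open>Elements of the right idealiser are codewords \<open>\<alpha> f(x) + \<beta> x\<close> too. There are at most \<open>q ^ 4\<close>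
  values of \<open>\<alpha>\<close>: shifted cyclically by the fifth Frobenius power, the equation for
  \<open>\<alpha>\<close> is polynomial of degree \<open>q ^ 4\<close>. For fixed \<open>\<alpha>\<close>, two values of \<open>\<beta>\<close> differ by an
  element fixed by the Frobenius map, which leaves at most \<open>q\<close> of them.\<close>
lemma card_right_idealiser_le:
  "card {N. \<forall>M\<in>code f. M ** N \<in> code f} \<le> q ^ 5"
proof -
  define R where "R = {(\<alpha>, \<beta>). \<exists>\<alpha>' \<beta>'. \<forall>y. f (\<alpha> * f y + \<beta> * y) = \<alpha>' * f y + \<beta>' * y}"
  define Z where "Z = {\<alpha>::'l. fr 1 \<alpha> + fr 2 \<alpha> + h\<^sup>2 * (fr 4 \<alpha> + fr 5 \<alpha>) = 0}"
  have lin: "base_linear (\<lambda>x. \<alpha> * f x + \<beta> * x)" for \<alpha> \<beta>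
    by (intro base_linear_add base_linear_scale base_linear_f_poly base_linear_mult)
  have f_diff: "f (x - y) = f x - f y" for x y
    by (simp add: f_poly_eq algebra_simps)
  have "{N. \<forall>M\<in>code f. M ** N \<in> code f} \<subseteq> (\<lambda>(\<alpha>, \<beta>). E (\<lambda>x. \<alpha> * f x + \<beta> * x)) ` R"
  proof safe
    fix N assume N: "\<forall>M\<in>code f. M ** N \<in> code f"
    then have "N \<in> code f" using id_mem_code[of f] by auto
    then obtain \<alpha> \<beta> where N_eq: "N = E (\<lambda>x. \<alpha> * f x + \<beta> * x)"
      using mem_codeE[OF base_linear_f_poly, of N] by metis
    have "E f \<in> code f" by (rule E_mem_code[OF base_linear_f_poly])
    then have "E (f \<circ> (\<lambda>x. \<alpha> * f x + \<beta> * x)) \<in> code f"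
      using N unfolding N_eq E_comp[OF base_linear_f_poly lin] by blast
    then have "(\<alpha>, \<beta>) \<in> R"
      unfolding E_mem_code_iff[OF base_linear_f_poly base_linear_comp[OF base_linear_f_poly lin]]
      by (simp add: R_def)
    then show "N \<in> (\<lambda>(\<alpha>, \<beta>). E (\<lambda>x. \<alpha> * f x + \<beta> * x)) ` R"
      using N_eq by force
  qed
  then have "card {N. \<forall>M\<in>code f. M ** N \<in> code f} \<le> card R"
    by (rule surj_card_le[rotated]) simp
  also have "R \<subseteq> (\<Union>\<alpha>\<in>Z. {\<alpha>} \<times> {\<beta>. (\<alpha>, \<beta>) \<in> R})"
  proof clarify
    fix \<alpha> \<beta> assume R: "(\<alpha>, \<beta>) \<in> R"
    then obtain \<alpha>' \<beta>' where "\<And>y. f (\<alpha> * f y + \<beta> * y) = \<alpha>' * f y + \<beta>' * y" by (auto simp: R_def)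
    then have "\<alpha> \<in> Z" unfolding Z_def using right_idealiser_coeff(1) by blast
    then show "(\<alpha>, \<beta>) \<in> (\<Union>\<alpha>\<in>Z. {\<alpha>} \<times> {\<beta>. (\<alpha>, \<beta>) \<in> R})" using R by simp
  qed
  then have "card R \<le> card (\<Union>\<alpha>\<in>Z. {\<alpha>} \<times> {\<beta>. (\<alpha>, \<beta>) \<in> R})"
    by (intro card_mono) auto
  also have "\<dots> \<le> (\<Sum>\<alpha>\<in>Z. card ({\<alpha>} \<times> {\<beta>. (\<alpha>, \<beta>) \<in> R}))"
    by (rule card_UN_le) simp
  also have "\<dots> \<le> (\<Sum>\<alpha>\<in>Z. q)"
  proof (rule sum_mono)
    fix \<alpha>
    show "card ({\<alpha>} \<times> {\<beta>. (\<alpha>, \<beta>) \<in> R}) \<le> q"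
    proof (cases "{\<beta>. (\<alpha>, \<beta>) \<in> R} = {}")
      case False
      then obtain \<beta>0 where b0: "(\<alpha>, \<beta>0) \<in> R" by auto
      have "{\<beta>. (\<alpha>, \<beta>) \<in> R} \<subseteq> (\<lambda>l. \<beta>0 + l) ` {l. fr 1 l = l}"
      proof
        fix \<beta> assume "\<beta> \<in> {\<beta>. (\<alpha>, \<beta>) \<in> R}"
        then obtain a1 d1 where 1: "\<And>y. f (\<alpha> * f y + \<beta> * y) = a1 * f y + d1 * y" by (auto simp: R_def)
        obtain a2 d2 where 2: "\<And>y. f (\<alpha> * f y + \<beta>0 * y) = a2 * f y + d2 * y" using b0 by (auto simp: R_def)
        have "f (0 * f y + (\<beta> - \<beta>0) * y) = (a1 - a2) * f y + (d1 - d2) * y" for y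
        proof -
          have "f (0 * f y + (\<beta> - \<beta>0) * y) = f ((\<alpha> * f y + \<beta> * y) - (\<alpha> * f y + \<beta>0 * y))"
            by (simp add: algebra_simps)
          also have "\<dots> = (a1 - a2) * f y + (d1 - d2) * y"
            unfolding f_diff 1 2 by (simp add: algebra_simps)
          finally show ?thesis .
        qed
        then have "fr 1 (\<beta> - \<beta>0) = \<beta> - \<beta>0" using right_idealiser_coeff(2)[of 0 "\<beta> - \<beta>0"] by blast
        then show "\<beta> \<in> (\<lambda>l. \<beta>0 + l) ` {l. fr 1 l = l}" by (intro image_eqI[of _ _ "\<beta> - \<beta>0"]) auto
      qed
      then have "card {\<beta>. (\<alpha>, \<beta>) \<in> R} \<le> card {l::'l. fr 1 l = l}"
        by (rule surj_card_le[rotated]) simp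
      then show ?thesis by (simp add: card_fixed card_cartesian_product)
    qed simp
  qed
  also have "\<dots> = card Z * q" by simp
  finally have "card {N. \<forall>M\<in>code f. M ** N \<in> code f} \<le> card Z * q" .
  moreover have "card Z \<le> q ^ 4"
  proof -
    define d where "d = (fr 5 h)\<^sup>2"
    have "{..4::nat} = {0, 1, 2, 3, 4}" by auto
    then have sum: "(\<Sum>i\<le>4. [1, 1, 0, d, d] ! i * fr i x) = x + fr 1 x + d * (fr 3 x + fr 4 x)" for x
      by (simp add: frob_def algebra_simps)
    have shift: "fr 5 (fr 1 x + fr 2 x + h\<^sup>2 * (fr 4 x + fr 5 x)) = x + fr 1 x + d * (fr 3 x + fr 4 x)" for x
      by (simp add: d_def)
    have "Z = {x. (\<Sum>i\<le>4. [1, 1, 0, d, d] ! i * fr i x) = 0}"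
      unfolding Z_def sum shift[symmetric] fr_eq_0_iff ..
    also have "card \<dots> \<le> q ^ 4"
      by (rule card_frob_roots[OF q_gt_1]) (simp add: d_def)
    finally show ?thesis .
  qed
  then have "card Z * q \<le> q ^ 4 * q" by simp
  moreover have "q ^ 4 * q = q ^ 5" using power_add[of q 4 1] by simp
  ultimately show ?thesis by linarith
qed

lemma f_poly_automorphism:
  assumes "field_embedding \<theta>"
  shows "\<theta> (f_poly q h x) = f_poly q (\<theta> h) (\<theta> x)"
  by (simp add: f_poly_def field_embedding_hom[OF assms])

text \<open>Transposition turns the left idealiser of the transposed code into the right idealiser of
  the code, so the \<open>q ^ 6\<close> multiplications in the left idealiser of the other
  code would have to fit into a set of at most \<open>q ^ 5\<close> elements.\<close>
lemma not_equivalent_transposed: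
  assumes A: "invertible A" and A2: "invertible A2" and \<sigma>: "field_automorphism \<sigma>" and g: "base_linear g"
  shows "(\<lambda>M. A ** map_matrix \<sigma> (transpose M) ** A2) ` code f \<noteq> code g"
proof
  assume "(\<lambda>M. A ** map_matrix \<sigma> (transpose M) ** A2) ` code f = code g"
  then have eq: "(\<lambda>M. A ** map_matrix \<sigma> M ** A2) ` (transpose ` code f) = code g"
    by (simp add: image_image)
  have "\<exists>P \<in> left_idealiser (transpose ` code f). E (\<lambda>x. \<beta> * x) ** A = A ** map_matrix \<sigma> P" for \<beta>
    by (rule left_idealiser_conjugate[OF A A2 \<sigma> eq mult_mem_left_idealiser[OF g]])
  then obtain P where P: "\<And>\<beta>. P \<beta> \<in> left_idealiser (transpose ` code f)"
    "\<And>\<beta>. E (\<lambda>x. \<beta> * x) ** A = A ** map_matrix \<sigma> (P \<beta>)" by metis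
  have "inj P"
  proof (rule injI)
    fix \<beta> \<gamma> assume "P \<beta> = P \<gamma>"
    then have "E (\<lambda>x. \<beta> * x) ** A = E (\<lambda>x. \<gamma> * x) ** A" by (simp add: P(2))
    moreover obtain A' where "A ** A' = mat 1" using A by (auto simp: invertible_def)
    ultimately have "E (\<lambda>x. \<beta> * x) = E (\<lambda>x. \<gamma> * x)"
      by (metis matrix_mul_assoc matrix_mul_rid)
    then show "\<beta> = \<gamma>" by (rule mult_E_inj)
  qed
  have R: "transpose (P \<beta>) \<in> {N. \<forall>M\<in>code f. M ** N \<in> code f}" for \<beta>
  proof safe
    fix M assume "M \<in> code f"
    then have "P \<beta> ** transpose M \<in> transpose ` code f" using P(1) by (auto simp: left_idealiser_def)
    then have "transpose (P \<beta> ** transpose M) \<in> code f" by auto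
    then show "M ** transpose (P \<beta>) \<in> code f" by (simp add: matrix_transpose_mul)
  qed
  have "inj (\<lambda>\<beta>. transpose (P \<beta>))"
    using \<open>inj P\<close> by (auto simp: inj_def)
  then have "CARD('l) = card (range (\<lambda>\<beta>. transpose (P \<beta>)))" by (simp add: card_image)
  also have "\<dots> \<le> card {N. \<forall>M\<in>code f. M ** N \<in> code f}"
    using R by (intro card_mono) auto
  also have "\<dots> \<le> q ^ 5" by (rule card_right_idealiser_le)
  also have "\<dots> < q ^ 6" using q_gt_1 by (intro power_strict_increasing) auto
  finally show False using card_l by simp
qed

text \<open>The identity and \<open>g\<close> both lie in the code of \<open>g\<close>, so they come from codewords \<open>M0\<close> and \<open>M1\<close> of \<open>f\<close>.
  Eliminating the right factor \<open>A2\<close> of the equivalence leaves \<open>g \<circ> (A M0\<^sup>\<sigma>) = A M1\<^sup>\<sigma>\<close>,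
  and the left factor acts as a scalar times a field automorphism \<open>\<theta>\<close>, which
  turns \<open>f\<close> into the member of the family with parameter \<open>\<theta>(h)\<close>.\<close>
lemma equivalence_imp_composition:
  assumes A: "invertible A" and A2: "invertible A2" and \<sigma>: "field_automorphism \<sigma>" and g: "base_linear g"
    and eq: "(\<lambda>M. A ** map_matrix \<sigma> M ** A2) ` code f = code g"
  obtains \<theta> \<alpha> \<beta> \<alpha>' \<beta>' where "field_automorphism \<theta>" "\<alpha> \<noteq> 0 \<or> \<beta> \<noteq> 0"
    "\<And>y. g (\<alpha> * f_poly q (\<theta> h) y + \<beta> * y) = \<alpha>' * f_poly q (\<theta> h) y + \<beta>' * y"
proof -
  have "\<exists>\<gamma>. E (\<lambda>x. \<beta> * x) ** A = A ** map_matrix \<sigma> (E (\<lambda>x. \<gamma> * x))" for \<beta>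
  proof -
    obtain P where "P \<in> left_idealiser (code f)" "E (\<lambda>x. \<beta> * x) ** A = A ** map_matrix \<sigma> P"
      using left_idealiser_conjugate[OF A A2 \<sigma> eq mult_mem_left_idealiser[OF g, of \<beta>]] by auto
    then show ?thesis by (auto simp: left_idealiser_code)
  qed
  then obtain \<tau> where \<tau>: "\<And>\<beta>. E (\<lambda>x. \<beta> * x) ** A = A ** map_matrix \<sigma> (E (\<lambda>x. \<tau> \<beta> * x))" by metis
  obtain \<theta> e where \<theta>: "field_automorphism \<theta>" and e: "e \<noteq> 0"
    and \<theta>1: "\<And>\<psi> x. base_linear \<psi> \<Longrightarrow>
       lc ((A ** map_matrix \<sigma> (E \<psi>)) *v map_vec \<sigma> (coords x)) = e * \<theta> (\<psi> x)"
    by (rule semilinear_idealiser_map[OF A \<sigma> finite \<tau>]) (rule that)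
  have emb: "field_embedding \<theta>" and "surj \<theta>" using \<theta> by (auto simp: field_automorphism_def bij_def)
  note \<theta>_hom = field_embedding_hom[OF emb]
  obtain M0 where M0: "M0 \<in> code f" "A ** map_matrix \<sigma> M0 ** A2 = mat 1"
    using id_mem_code[of g] eq by force
  have "E g \<in> code g" by (rule E_mem_code[OF g])
  then obtain M1 where M1: "M1 \<in> code f" "A ** map_matrix \<sigma> M1 ** A2 = E g"
    using eq by force
  obtain u v where M0_eq: "M0 = E (\<lambda>x. u * f x + v * x)" and lin0: "base_linear (\<lambda>x. u * f x + v * x)"
    using mem_codeE[OF base_linear_f_poly M0(1)] by metis
  obtain s t where M1_eq: "M1 = E (\<lambda>x. s * f x + t * x)" and lin1: "base_linear (\<lambda>x. s * f x + t * x)"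
    using mem_codeE[OF base_linear_f_poly M1(1)] by metis
  have "A2 ** (A ** map_matrix \<sigma> M0) = mat 1"
    using M0(2) matrix_left_right_inverse by blast
  then have comp: "E g ** (A ** map_matrix \<sigma> M0) = A ** map_matrix \<sigma> M1"
    unfolding M1(2)[symmetric] by (metis matrix_mul_assoc matrix_mul_rid)
  have g_\<theta>: "g (e * \<theta> (u * f x + v * x)) = e * \<theta> (s * f x + t * x)" for x
  proof -
    have "g (e * \<theta> (u * f x + v * x)) = g (lc ((A ** map_matrix \<sigma> M0) *v map_vec \<sigma> (coords x)))"
      unfolding M0_eq \<theta>1[OF lin0] ..
    also have "\<dots> = lc (E g *v ((A ** map_matrix \<sigma> M0) *v map_vec \<sigma> (coords x)))"
      by (simp add: E_works[OF g])
    also have "\<dots> = lc ((A ** map_matrix \<sigma> M1) *v map_vec \<sigma> (coords x))"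
      by (simp only: matrix_vector_mul_assoc comp)
    also have "\<dots> = e * \<theta> (s * f x + t * x)"
      unfolding M1_eq \<theta>1[OF lin1] ..
    finally show ?thesis .
  qed
  have "g ((e * \<theta> u) * f_poly q (\<theta> h) (\<theta> x) + (e * \<theta> v) * \<theta> x)
      = (e * \<theta> s) * f_poly q (\<theta> h) (\<theta> x) + (e * \<theta> t) * \<theta> x" for x
    using g_\<theta>[of x] by (simp add: \<theta>_hom f_poly_automorphism[OF emb] distrib_left mult.assoc)
  then have H: "g ((e * \<theta> u) * f_poly q (\<theta> h) y + (e * \<theta> v) * y)
      = (e * \<theta> s) * f_poly q (\<theta> h) y + (e * \<theta> t) * y" for y
    using \<open>surj \<theta>\<close> by (metis surjD)
  have "e * \<theta> u \<noteq> 0 \<or> e * \<theta> v \<noteq> 0"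
  proof (rule ccontr)
    assume "\<not> (e * \<theta> u \<noteq> 0 \<or> e * \<theta> v \<noteq> 0)"
    then have "\<theta> u = \<theta> 0" "\<theta> v = \<theta> 0" using e \<theta>_hom(1) by auto
    then have "u = 0" "v = 0" using field_embedding_inj[OF emb] by (auto simp: inj_eq)
    then have "lc ((A ** map_matrix \<sigma> M0) *v map_vec \<sigma> (coords x)) = 0" for x
      unfolding M0_eq \<theta>1[OF lin0] by (simp add: \<theta>_hom(1))
    then have z: "(A ** map_matrix \<sigma> M0) *v map_vec \<sigma> (coords x) = 0" for x
      by (metis lc_0 lc_eq_iff)
    have "map_vec \<sigma> (coords x) = 0" for x
      using z[of x] \<open>A2 ** (A ** map_matrix \<sigma> M0) = mat 1\<close>
      by (metis matrix_vector_mul_assoc matrix_vector_mul_lid matrix_vector_mult_0_right)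
    then have "coords 0 = coords 1"
      using map_vec_inj[of \<sigma>] \<sigma> unfolding field_automorphism_def bij_def by (metis injD)
    then show False by (metis lc_coords zero_neq_one)
  qed
  then show ?thesis using that[OF \<theta> _ H] by blast
qed

lemma not_equivalent_known:
  assumes g: "g \<in> known_scattered q" and exc: "\<not> (h \<in> range \<iota> \<and> (\<exists>k. q = 5 ^ k))"
  shows "\<not> code_equivalent (code f) (code g)"
proof
  assume "code_equivalent (code f) (code g)"
  then obtain A A2 \<sigma> where A: "invertible A" "invertible A2" "field_automorphism \<sigma>"
    and eq: "(\<lambda>M. A ** map_matrix \<sigma> M ** A2) ` code f = code g \<or>
        (\<lambda>M. A ** map_matrix \<sigma> (transpose M) ** A2) ` code f = code g"
    unfolding code_equivalent_def by (elim exE conjE) (rule that)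
  have fr1: "x ^ q = fr 1 x" for x :: 'l by (simp add: frob_def)
  have frn: "x ^ (q ^ n) = fr n x" for x :: 'l and n by (simp add: frob_def)
  have lin: "base_linear g"
    using g by cases (auto simp: fr1 frn intro!: base_linear_add base_linear_scale base_linear_fr)
  then have "(\<lambda>M. A ** map_matrix \<sigma> M ** A2) ` code f = code g"
    using eq not_equivalent_transposed[OF A lin] by blast
  then obtain \<theta> \<alpha> \<beta> \<alpha>' \<beta>' where \<theta>: "field_automorphism \<theta>" and nz: "\<alpha> \<noteq> 0 \<or> \<beta> \<noteq> 0"
    and H: "\<And>y. g (\<alpha> * f_poly q (\<theta> h) y + \<beta> * y) = \<alpha>' * f_poly q (\<theta> h) y + \<beta>' * y"
    using equivalence_imp_composition[OF A lin] by metis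
  have emb: "field_embedding \<theta>" using \<theta> by (simp add: field_automorphism_def)
  note \<theta>_hom = field_embedding_hom[OF emb]
  interpret T: f_family q "\<theta> h"
  proof
    have "\<theta> h ^ (q ^ 3 + 1) = \<theta> (h ^ (q ^ 3 + 1))" by (simp only: \<theta>_hom(7))
    then show "\<theta> h ^ (q ^ 3 + 1) = - 1" by (simp only: h_norm \<theta>_hom)
  qed (rule primepow_q odd_q card_l)+
  show False
    using g
  proof cases
    case pseudoregulus
    then show False using T.pseudoregulus_composition[of \<alpha> \<beta> \<alpha>' \<beta>'] H nz by (simp add: fr1)
  next
    case (lunardon_polverino \<delta>)
    have "norm6 q 1 (0::'l) = 0"
      unfolding norm6_def using q_gt_1 by (intro prod_zero bexI[of _ 0]) auto
    then have "\<delta> \<noteq> 0" using lunardon_polverino by auto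
    then show False
      using T.lunardon_polverino_composition[of \<delta> \<alpha> \<beta> \<alpha>' \<beta>'] H nz lunardon_polverino by (simp add: fr1 frn)
  next
    case (binomial \<delta>)
    then show False using T.binomial_composition[of \<alpha> \<beta> \<delta> \<alpha>' \<beta>'] H nz by (simp add: fr1 frn)
  next
    case (trinomial \<delta>)
    then have "fr 1 (\<theta> h) = \<theta> h \<and> (5::'l) = 0"
      using T.trinomial_composition[of \<alpha> \<beta> \<delta> \<alpha>' \<beta>'] H nz by (simp add: fr1 frn)
    moreover have "fr 1 (\<theta> h) = \<theta> (fr 1 h)" by (simp add: frob_def \<theta>_hom)
    ultimately have "fr 1 h = h" and five: "(5::'l) = 0"
      using field_embedding_inj[OF emb] by (auto simp: inj_eq)
    then have "h \<in> range \<iota>" by (simp add: range_\<iota>)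
    moreover obtain k where k: "prime CHAR('l)" "q = CHAR('l) ^ k"
      using primepow_card_CHAR[OF primepow_q card_l] by metis
    moreover have "CHAR('l) dvd 5" using five by (simp flip: of_nat_eq_0_iff_char_dvd)
    then have "CHAR('l) = 5" using k(1) by (intro primes_dvd_imp_eq) auto
    ultimately show False using exc by metis
  qed
qed

end

theorem theorem4p1:
  fixes q :: nat
    and \<iota> :: "'k::{field,finite} \<Rightarrow> 'l::{field,finite}"
    and b :: "6 \<Rightarrow> 'l"
    and h :: 'l
  assumes "primepow q" and "odd q"
    and "CARD('k) = q" and "CARD('l) = q ^ 6"
    and "field_embedding \<iota>"
    and "ext_basis \<iota> b"
    and "h ^ (q ^ 3 + 1) = -1"
  shows "linear_code (poly_matrix_code \<iota> b (f_poly q h)) \<and>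
    MRD_code (poly_matrix_code \<iota> b (f_poly q h)) \<and>
    code_parameters (poly_matrix_code \<iota> b (f_poly q h)) 6 6 q 5 \<and>
    (\<exists>\<phi> :: 'l \<Rightarrow> 'k^6^6.
       matrix_ring_iso \<phi> (left_idealiser (poly_matrix_code \<iota> b (f_poly q h)))) \<and>
    (\<not> (h \<in> range \<iota> \<and> (\<exists>k. q = 5 ^ k)) \<longrightarrow>
       (\<forall>g \<in> known_scattered q.
          \<not> code_equivalent (poly_matrix_code \<iota> b (f_poly q h)) (poly_matrix_code \<iota> b g)))"
proof -
  interpret f_code q h \<iota> b
    by (intro f_code.intro f_family.intro extension_basis.intro f_code_axioms.intro assms)
  have "MRD_code (code f)"
    unfolding MRD_code_def using min_distance_code by (intro exI[of _ 5]) (simp add: card_code card_k)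
  moreover have "code_parameters (code f) 6 6 q 5"
    using min_distance_code by (simp add: code_parameters_def card_k)
  ultimately show ?thesis
    using poly_matrix_code_linear[OF base_linear_f_poly] matrix_ring_iso_left_idealiser not_equivalent_known
    by blast
qed

end
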